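(* Let $m,n\ge 1$ be integers, let $\nu>m-1$ and $\rho^2>0$ be real numbers, let $\mu_0\in\mathbb{R}^m$, and let $\Sigma_0\in\mathbb{R}^{m\times m}$ be symmetric positive definite. For $\mu\in\mathbb{R}^m$ and a symmetric positive definite $\Sigma\in\mathbb{R}^{m\times m}$ let $$f(x^n;\mu,\Sigma)=\frac{1}{(2\pi)^{mn/2}|\Sigma|^{n/2}}\exp\Big\{-\frac12\sum_{i=1}^n (x_i-\mu)^\top\Sigma^{-1}(x_i-\mu)\Big\},\qquad x^n=(x_1,\dots,x_n)\in(\mathbb{R}^m)^n,$$ and let the luckiness function be $$w(\mu,\Sigma)=\frac{1}{(2\pi)^{m\nu/2}|\Sigma|^{\nu/2}}\exp\Big[-\frac{\nu}{2}\operatorname{tr}\big\{\Sigma^{-1}\big(\Sigma_0+\rho^2(\mu-\mu_0)(\mu-\mu_0)^\top\big)\big\}\Big].$$ Then the capacity $$C=\int_{(\mathbb{R}^m)^n}\ \max_{\mu\in\mathbb{R}^m,\ \Sigma>0} f(x^n;\mu,\Sigma)\,w(\mu,\Sigma)\,dx^n$$ equals $$C=\mathcal{C}(m,n,\nu,|\Sigma_0|^{1/m},\rho^2),$$ where, for $s>0$, $\mathcal{C}(m,n,\nu,s,\rho^2):=s^{-m\nu/2}\left(\frac{(n+\nu)^{n+\nu}(1+\frac{n}{\rho^2\nu})}{(2e)^{n+\nu}(\pi\nu)^{\nu}}\right)^{m/2}\frac{\Gamma_m(\frac{\nu}{2})}{\Gamma_m(\frac{n+\nu}{2})}$. The corresponding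 LNML density $\bar p_n(x^n)=\frac1C\max_{\mu\in\mathbb{R}^m,\Sigma>0}f(x^n;\mu,\Sigma)w(\mu,\Sigma)$ is given, for every $x^n\in(\mathbb{R}^m)^n$, by $$\bar p_n(x^n)=\frac{f(x^n;\bar\mu_n,\bar\Sigma_n)\,w(\bar\mu_n,\bar\Sigma_n)}{\mathcal{C}(m,n,\nu,|\Sigma_0|^{1/m},\rho^2)}=\left(\frac{\nu^{\nu}}{\pi^n(n+\nu)^{n+\nu}\big(1+\frac{n}{\rho^2\nu}\big)}\right)^{m/2}\frac{\Gamma_m(\frac{n+\nu}{2})}{\Gamma_m(\frac{\nu}{2})}\,\frac{|\Sigma_0|^{\frac{\nu}{2}}}{|\bar\Sigma_n|^{\frac{n+\nu}{2}}},$$ where $$\bar\mu_n=\mu_0+\frac{1}{n+\rho^2\nu}\sum_{i=1}^n (x_i-\mu_0),$$ $$\bar\Sigma_n=\frac{1}{n+\nu}\Big(\sum_{i=1}^n (x_i-\mu_0)(x_i-\mu_0)^\top+\nu\Sigma_0\Big)-\frac{1}{(\nu+n)(\rho^2\nu+n)}\sum_{i,j=1}^n (x_i-\mu_0)(x_j-\mu_0)^\top$$ are the maximum a-posteriori probability (MAP) estimates under the prior proportional to $w$, i.e. $(\bar\mu_n,\bar\Sigma_n)$ maximizes $(\mu,\Sigma)\mapsto f(x^n;\mu,\Sigma)w(\mu,\Sigma)$ over $\mu\in\mathbb{R}^m$, $\Sigma>0$.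
   Context: Here $\Sigma>0$ means that $\Sigma$ is a symmetric positive definite matrix, $|\cdot|$ of a matrix denotes its determinant, $\pi$ is the usual constant, and $dx^n$ is Lebesgue measure on $(\mathbb{R}^m)^n$. The multivariate gamma function is $\Gamma_m(z)=\pi^{m(m-1)/4}\prod_{j=0}^{m-1}\Gamma(z-\frac j2)$. Normalized maximum likelihood with luckiness (LNML): given a parametric family of densities $f(x^n;\theta)$, $\theta\in\Theta$, and a luckiness function $w:\Theta\to(0,\infty)$, the capacity is $C=\int\max_{\theta\in\Theta}f(x^n;\theta)w(\theta)\,dx^n$ and the LNML density is $\bar p_n(x^n)=\max_{\theta\in\Theta}f(x^n;\theta)w(\theta)/C$. *)

theory Defs
  imports "HOL-Analysis.Analysis"
begin

section \<open>Normalized maximum likelihood with luckiness\<close>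

text \<open>
  \<open>p x \<theta>\<close> is the model density at the data \<open>x\<close>, and \<open>w\<close> is the luckiness function on the
  parameter set \<open>\<Theta>\<close>. The maximum is taken literally, as the greatest element of the set of
  attained values, so it is only meaningful where the maximum is attained.
\<close>

definition lnml_max :: "('x \<Rightarrow> 't \<Rightarrow> real) \<Rightarrow> ('t \<Rightarrow> real) \<Rightarrow> 't set \<Rightarrow> 'x \<Rightarrow> real"
  where "lnml_max p w \<Theta> x = (GREATEST y. \<exists>\<theta>\<in>\<Theta>. y = p x \<theta> * w \<theta>)"

definition lnml_capacity ::
    "('x::euclidean_space \<Rightarrow> 't \<Rightarrow> real) \<Rightarrow> ('t \<Rightarrow> real) \<Rightarrow> 't set \<Rightarrow> real"
  where "lnml_capacity p w \<Theta> = (\<integral>x. lnml_max p w \<Theta> x \<partial>lborel)"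

definition lnml_density ::
    "('x::euclidean_space \<Rightarrow> 't \<Rightarrow> real) \<Rightarrow> ('t \<Rightarrow> real) \<Rightarrow> 't set \<Rightarrow> 'x \<Rightarrow> real"
  where "lnml_density p w \<Theta> x = lnml_max p w \<Theta> x / lnml_capacity p w \<Theta>"


section \<open>Matrices\<close>

definition pos_def_matrix :: "real^'m^'m \<Rightarrow> bool"
  where "pos_def_matrix A \<longleftrightarrow> transpose A = A \<and> (\<forall>v. v \<noteq> 0 \<longrightarrow> 0 < v \<bullet> (A *v v))"

definition outer :: "real^'m \<Rightarrow> real^'m \<Rightarrow> real^'m^'m"
  where "outer u v = (\<chi> i j. u $ i * v $ j)"


section \<open>The multivariate normal model with unknown mean and covariance\<close>

text \<open>
  A sample of size \<open>n = CARD('n)\<close> in dimension \<open>m = CARD('m)\<close> is \<open>x :: real^'m^'n\<close>, with \<open>x $ i\<close> the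
  \<open>i\<close>-th observation; the parameter is the pair \<open>(\<mu>, \<Sigma>)\<close>.
\<close>

definition normal_params :: "((real^'m) \<times> (real^'m^'m)) set"
  where "normal_params = UNIV \<times> {\<Sigma>. pos_def_matrix \<Sigma>}"

definition normal_lik :: "real^'m^'n \<Rightarrow> (real^'m) \<times> (real^'m^'m) \<Rightarrow> real"
  where "normal_lik x = (\<lambda>(\<mu>, \<Sigma>).
    1 / ((2 * pi) powr (real CARD('m) * real CARD('n) / 2) * det \<Sigma> powr (real CARD('n) / 2)) *
    exp (- (1 / 2) * (\<Sum>i\<in>UNIV. (x $ i - \<mu>) \<bullet> (matrix_inv \<Sigma> *v (x $ i - \<mu>)))))"

text \<open>The argument \<open>\<rho>2\<close> here and below stands for \<open>\<rho>\<^sup>2\<close>; it is not squared again.\<close>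

definition normal_luckiness ::
    "real \<Rightarrow> real \<Rightarrow> real^'m \<Rightarrow> real^'m^'m \<Rightarrow> (real^'m) \<times> (real^'m^'m) \<Rightarrow> real"
  where "normal_luckiness \<nu> \<rho>2 \<mu>0 \<Sigma>0 = (\<lambda>(\<mu>, \<Sigma>).
    1 / ((2 * pi) powr (real CARD('m) * \<nu> / 2) * det \<Sigma> powr (\<nu> / 2)) *
    exp (- (\<nu> / 2) * trace (matrix_inv \<Sigma> ** (\<Sigma>0 + \<rho>2 *\<^sub>R outer (\<mu> - \<mu>0) (\<mu> - \<mu>0)))))"

definition map_mean :: "real \<Rightarrow> real \<Rightarrow> real^'m \<Rightarrow> real^'m^'n \<Rightarrow> real^'m"
  where "map_mean \<nu> \<rho>2 \<mu>0 x =
    \<mu>0 + (1 / (real CARD('n) + \<rho>2 * \<nu>)) *\<^sub>R (\<Sum>i\<in>UNIV. x $ i - \<mu>0)"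

definition map_cov :: "real \<Rightarrow> real \<Rightarrow> real^'m \<Rightarrow> real^'m^'m \<Rightarrow> real^'m^'n \<Rightarrow> real^'m^'m"
  where "map_cov \<nu> \<rho>2 \<mu>0 \<Sigma>0 x =
    (1 / (real CARD('n) + \<nu>)) *\<^sub>R
      ((\<Sum>i\<in>UNIV. outer (x $ i - \<mu>0) (x $ i - \<mu>0)) + \<nu> *\<^sub>R \<Sigma>0) -
    (1 / ((\<nu> + real CARD('n)) * (\<rho>2 * \<nu> + real CARD('n)))) *\<^sub>R
      (\<Sum>i\<in>UNIV. \<Sum>j\<in>UNIV. outer (x $ i - \<mu>0) (x $ j - \<mu>0))"


section \<open>The closed form of the capacity\<close>

definition multi_Gamma :: "nat \<Rightarrow> real \<Rightarrow> real"
  where "multi_Gamma m z =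
    pi powr (real m * (real m - 1) / 4) * (\<Prod>j<m. Gamma (z - real j / 2))"

definition capacity_formula :: "nat \<Rightarrow> nat \<Rightarrow> real \<Rightarrow> real \<Rightarrow> real \<Rightarrow> real"
  where "capacity_formula m n \<nu> s \<rho>2 =
    s powr (- (real m * \<nu> / 2)) *
    (((real n + \<nu>) powr (real n + \<nu>) * (1 + real n / (\<rho>2 * \<nu>))) /
      ((2 * exp 1) powr (real n + \<nu>) * (pi * \<nu>) powr \<nu>)) powr (real m / 2) *
    (multi_Gamma m (\<nu> / 2) / multi_Gamma m ((real n + \<nu>) / 2))"

end

theory Submission
  imports Defs "HOL-Probability.Distributions"
begin

text \<open>
  Let \<open>m = CARD('m)\<close>, \<open>n = CARD('n)\<close>, \<open>N = n + \<nu>\<close> and \<open>K = n + \<rho>2 * \<nu>\<close>.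

  \<^emph>\<open>Maximization.\<close> The luckiness function enters the exponents like \<open>\<nu>\<close> additional observations, so the
  penalised likelihood at \<open>(\<mu>, \<Sigma>)\<close> is a constant times \<open>det \<Sigma> powr - (N / 2)\<close> times \<open>exp (- t / 2)\<close>, where \<open>t\<close> is the
  trace of \<open>\<Sigma>\<inverse>\<close> times a matrix that is quadratic in \<open>\<mu>\<close>. Completing the square in \<open>\<mu>\<close>
  (\<open>complete_square\<close>) splits this matrix into \<open>N\<close> times the MAP covariance \<open>S\<close> and \<open>K\<close> times the
  outer square of the difference between \<open>\<mu>\<close> and the MAP mean. The best \<open>\<mu>\<close> is therefore the MAP mean for every \<open>\<Sigma>\<close>, and
  \<open>\<Sigma> = S\<close> is best because \<open>ln (det P) \<le> trace P - m\<close> for every positive definite \<open>P\<close>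
  (\<open>ln_det_le_trace\<close>, from the spectral theorem), applied to \<open>P = L\<^sup>T \<Sigma>\<inverse> L\<close> with \<open>S = L L\<^sup>T\<close>.
  The maximum is a constant times \<open>det S powr - (N / 2)\<close>.

  \<^emph>\<open>Integration.\<close> Up to the factor \<open>1 / N\<close>, \<open>S\<close> is \<open>\<nu> \<Sigma>0\<close> plus the scatter matrix of the centred
  observations minus the outer square of their sum divided by \<open>K\<close>. The integral of a power of such a
  determinant can be computed one observation at a time. Completing the square in a single
  observation \<open>y\<close> writes the matrix as \<open>B + d *\<^sub>R outer (y - v) (y - v)\<close> with \<open>d > 0\<close>, where \<open>v\<close> and
  \<open>B\<close> do not depend on \<open>y\<close> and \<open>B\<close> has the same form with one observation less
  (\<open>scatter_insert\<close>). The integral over \<open>y\<close> is elementary and gives a power of \<open>det B\<close> with the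
  exponent changed by one half (\<open>nn_integral_det_rank_one_update\<close>), so induction applies
  (\<open>nn_integral_det_scatter\<close>). Each step contributes a ratio of two Gamma values, and the product of
  these ratios rearranges to a ratio of multivariate gamma functions (\<open>prod_Gamma_telescope\<close>).
\<close>

section \<open>The spectral theorem for real symmetric matrices\<close>

lemma inner_matrix_symmetric:
  fixes A :: "real^'m^'m"
  assumes "transpose A = A"
  shows "u \<bullet> (A *v v) = (A *v u) \<bullet> v"
  by (metis assms dot_lmul_matrix transpose_matrix_vector)

text \<open>
  The quadratic form of \<open>A\<close> attains its maximum over the unit sphere of \<open>S\<close>, and a maximizer \<open>v\<close>
  is an eigenvector: the first variation vanishes in every direction of \<open>S\<close> orthogonal to \<open>v\<close>, and
  \<open>A v - c v\<close> is itself such a direction.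
\<close>

lemma Rayleigh_maximum_eigenvector:
  fixes A :: "real^'m^'m"
  assumes sym: "transpose A = A" and S: "subspace S" and inv: "\<And>x. x \<in> S \<Longrightarrow> A *v x \<in> S"
    and nontriv: "S \<noteq> {0}"
  obtains v c where "v \<in> S" "norm v = 1" "A *v v = c *\<^sub>R v"
proof -
  have ne: "S \<inter> sphere 0 1 \<noteq> {}"
  proof -
    obtain x where x: "x \<in> S" "x \<noteq> 0"
      using nontriv subspace_0[OF S] by auto
    then have "x /\<^sub>R norm x \<in> S \<inter> sphere 0 1"
      by (simp add: subspace_scale[OF S])
    then show ?thesis by blast
  qed
  have "compact (S \<inter> sphere 0 1)"
    by (simp add: closed_Int_compact closed_subspace[OF S])
  moreover have "continuous_on (S \<inter> sphere 0 1) (\<lambda>x. x \<bullet> (A *v x))"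
    by (intro continuous_intros linear_continuous_on matrix_vector_mul_bounded_linear)
  ultimately obtain v where v: "v \<in> S" "norm v = 1"
    and max: "\<And>x. x \<in> S \<Longrightarrow> norm x = 1 \<Longrightarrow> x \<bullet> (A *v x) \<le> v \<bullet> (A *v v)"
    using continuous_attains_sup[OF _ ne] by force
  define c where "c = v \<bullet> (A *v v)"
  have le: "x \<bullet> (A *v x) \<le> c * (norm x)\<^sup>2" if "x \<in> S" for x
  proof (cases "x = 0")
    case False
    have "(x /\<^sub>R norm x) \<bullet> (A *v (x /\<^sub>R norm x)) \<le> c"
      unfolding c_def using max[of "x /\<^sub>R norm x"] that False by (simp add: subspace_scale[OF S])
    then show ?thesis
      using False by (simp add: matrix_vector_mult_scaleR field_simps power2_eq_square)
  qed simp
  \<comment> \<open>moving from \<open>v\<close> to \<open>v + t w\<close> changes \<open>x \<bullet> A x - c |x|\<^sup>2\<close> by \<open>2 t b - t\<^sup>2 g\<close>,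
    which has to stay nonpositive for all \<open>t\<close>\<close>
  have crit: "w \<bullet> (A *v v) = 0" if w: "w \<in> S" "w \<bullet> v = 0" for w
  proof -
    define b where "b = w \<bullet> (A *v v)"
    define g where "g = c * (norm w)\<^sup>2 - w \<bullet> (A *v w)"
    have *: "2 * t * b \<le> t\<^sup>2 * g" for t
    proof -
      have "v + t *\<^sub>R w \<in> S"
        using v w S by (simp add: subspace_add subspace_scale)
      from le[OF this] have "(v + t *\<^sub>R w) \<bullet> (A *v (v + t *\<^sub>R w)) \<le> c * (norm (v + t *\<^sub>R w))\<^sup>2" .
      moreover have "(v + t *\<^sub>R w) \<bullet> (A *v (v + t *\<^sub>R w)) = c + 2 * t * b + t\<^sup>2 * (w \<bullet> (A *v w))"
        using inner_matrix_symmetric[OF sym, of v w]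
        by (simp add: matrix_vector_right_distrib matrix_vector_mult_scaleR inner_add_left
              inner_add_right c_def b_def power2_eq_square inner_commute algebra_simps)
      moreover have "(norm (v + t *\<^sub>R w))\<^sup>2 = 1 + t\<^sup>2 * (norm w)\<^sup>2"
        using v w unfolding power2_norm_eq_inner
        by (simp add: inner_add_left inner_add_right inner_commute power2_eq_square norm_eq_1)
      ultimately show ?thesis
        by (simp add: g_def algebra_simps)
    qed
    have "b = 0"
    proof (rule ccontr)
      assume "b \<noteq> 0"
      \<comment> \<open>a step that is small enough for the linear term to dominate\<close>
      define s where "s = b / (1 + \<bar>g\<bar>)"
      have "s\<^sup>2 * g \<le> s\<^sup>2 * (1 + \<bar>g\<bar>)" by (intro mult_left_mono) auto
      also have "\<dots> = s * b" by (simp add: s_def power2_eq_square)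
      finally have "2 * s * b \<le> s * b" using *[of s] by linarith
      moreover have "s * b > 0" using \<open>b \<noteq> 0\<close> by (simp add: s_def power2_eq_square[symmetric] add_pos_nonneg)
      ultimately show False by (simp add: mult.commute)
    qed
    then show ?thesis by (simp add: b_def)
  qed
  define w where "w = A *v v - c *\<^sub>R v"
  have "w \<in> S" using v inv S by (simp add: w_def subspace_diff subspace_scale)
  moreover have wv: "w \<bullet> v = 0"
    using v(2) by (simp add: w_def c_def inner_diff_left inner_diff_right inner_commute norm_eq_1)
  ultimately have "w \<bullet> (A *v v) = 0" by (rule crit)
  then have "w \<bullet> w = 0" using wv by (simp add: w_def inner_diff_right inner_commute)
  then have "A *v v = c *\<^sub>R v" by (simp add: w_def)
  with v that show thesis by blast
qed

lemma diagonal_matrix_vector_mult: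
  fixes x :: "real^'m"
  shows "(\<chi> i j. if i = j then d i else 0) *v x = (\<chi> i. d i * x $ i)"
  by (simp add: vec_eq_iff matrix_vector_mult_def if_distrib[of "\<lambda>z. z * _"] cong: if_cong)

text \<open>
  An orthonormal set of eigenvectors of maximal cardinality spans the space. Its orthogonal
  complement is invariant under \<open>A\<close>, so if it were nontrivial, it would contain one more eigenvector.
\<close>

lemma symmetric_matrix_diagonalizable:
  fixes A :: "real^'m^'m"
  assumes sym: "transpose A = A"
  obtains Q d where "orthogonal_matrix Q" "A = Q ** (\<chi> i j. if i = j then d i else 0) ** transpose Q"
proof -
  define P where "P B \<longleftrightarrow> pairwise orthogonal B \<and> (\<forall>b\<in>B. norm b = 1 \<and> (\<exists>c. A *v b = c *\<^sub>R b))"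
    for B
  have indep: "independent B" if "P B" for B
    using that by (intro pairwise_orthogonal_independent) (auto simp: P_def)
  have bound: "finite B \<and> card B \<le> CARD('m)" if "P B" for B
    using independent_bound[OF indep[OF that]] by simp
  have "P {}" by (simp add: P_def)
  moreover have "\<forall>B. P B \<longrightarrow> card B < Suc CARD('m)"
    using bound by (simp add: less_Suc_eq_le)
  ultimately obtain B where PB: "P B" and maxB: "\<And>B'. P B' \<Longrightarrow> card B' \<le> card B"
    using ex_has_greatest_nat[of P "{}" card] by blast
  have B: "pairwise orthogonal B" "\<And>b. b \<in> B \<Longrightarrow> norm b = 1" "\<And>b. b \<in> B \<Longrightarrow> \<exists>c. A *v b = c *\<^sub>R b"
    using PB by (auto simp: P_def)
  define S where "S = {x. \<forall>b\<in>B. b \<bullet> x = 0}"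
  have S: "subspace S" by (auto simp: S_def subspace_def inner_add_right)
  have inv: "A *v x \<in> S" if "x \<in> S" for x
    unfolding S_def
  proof (clarify)
    fix b assume "b \<in> B"
    then obtain c where "A *v b = c *\<^sub>R b" using B by blast
    then show "b \<bullet> (A *v x) = 0"
      using that \<open>b \<in> B\<close> inner_matrix_symmetric[OF sym, of b x] by (simp add: S_def)
  qed
  have "S = {0}"
  proof (rule ccontr)
    assume "S \<noteq> {0}"
    then obtain v c where v: "v \<in> S" "norm v = 1" "A *v v = c *\<^sub>R v"
      using Rayleigh_maximum_eigenvector[OF sym S inv] by blast
    then have "v \<notin> B" using norm_eq_1 by (auto simp: S_def)
    moreover have "P (insert v B)"
      using v B by (auto simp: P_def pairwise_insert orthogonal_def S_def inner_commute)
    ultimately show False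
      using maxB[of "insert v B"] bound[OF PB] by simp
  qed
  have "span B = UNIV"
  proof (rule ccontr)
    assume "span B \<noteq> UNIV"
    then obtain x where "x \<noteq> 0" "\<And>y. y \<in> span B \<Longrightarrow> orthogonal x y"
      using orthogonal_to_subspace_exists_gen[of B UNIV] by (metis UNIV_I psubsetI span_UNIV subset_UNIV)
    then have "x \<in> S" by (auto simp: S_def orthogonal_def span_base inner_commute)
    with \<open>S = {0}\<close> \<open>x \<noteq> 0\<close> show False by simp
  qed
  then have "card B = CARD('m)"
    using indep[OF PB] by (metis dim_UNIV dim_eq_card_independent dim_span DIM_cart DIM_real mult.right_neutral)
  then obtain f :: "'m \<Rightarrow> real^'m" where f: "bij_betw f UNIV B"
    using bound[OF PB] by (metis finite_class.finite_UNIV finite_same_card_bij)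
  define Q :: "real^'m^'m" where "Q = (\<chi> i j. f j $ i)"
  have col: "column j Q = f j" for j by (simp add: Q_def column_def vec_eq_iff)
  have fB: "f j \<in> B" for j using f by (auto simp: bij_betw_def)
  have Q: "orthogonal_matrix Q"
    unfolding orthogonal_matrix_orthonormal_columns col
  proof (intro conjI allI impI)
    show "norm (f i) = 1" for i using B fB by blast
    show "orthogonal (f i) (f j)" if "i \<noteq> j" for i j
      using B fB[of i] fB[of j] that f by (auto simp: pairwise_def bij_betw_def inj_eq)
  qed
  have "\<forall>j. \<exists>c. A *v f j = c *\<^sub>R f j" using B(3) fB by blast
  then obtain d where d: "\<And>j. A *v f j = d j *\<^sub>R f j" using choice by metis
  let ?D = "\<chi> i j. if i = j then d i else 0"
  have "A ** Q = Q ** ?D"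
  proof (simp add: vec_eq_iff, intro allI)
    fix i j
    have "(A ** Q) $ i $ j = (A *v f j) $ i"
      by (simp add: matrix_matrix_mult_def matrix_vector_mult_def Q_def)
    also have "\<dots> = (Q ** ?D) $ i $ j"
      by (simp add: d matrix_matrix_mult_def Q_def if_distrib[of "\<lambda>z. _ * z"] cong: if_cong)
    finally show "(A ** Q) $ i $ j = (Q ** ?D) $ i $ j" .
  qed
  then have "A ** (Q ** transpose Q) = Q ** ?D ** transpose Q" by (simp add: matrix_mul_assoc)
  then have "A = Q ** ?D ** transpose Q" using Q by (simp add: orthogonal_matrix_def)
  with Q that show thesis by blast
qed

section \<open>Positive definite matrices\<close>

lemma pos_def_diagonalizable:
  fixes B :: "real^'m^'m"
  assumes B: "pos_def_matrix B"
  obtains Q d where "orthogonal_matrix Q"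
    "B = Q ** (\<chi> i j. if i = j then d i else 0) ** transpose Q" "\<And>i. d i > 0"
proof -
  have sym: "transpose B = B" and pos: "\<And>v. v \<noteq> 0 \<Longrightarrow> 0 < v \<bullet> (B *v v)"
    using B by (auto simp: pos_def_matrix_def)
  obtain Q d where Q: "orthogonal_matrix Q"
    and BQ: "B = Q ** (\<chi> i j. if i = j then d i else 0) ** transpose Q"
    using symmetric_matrix_diagonalizable[OF sym] by blast
  let ?D = "(\<chi> i j. if i = j then d i else 0) :: real^'m^'m"
  have QQ: "transpose Q ** Q = mat 1"
    using Q by (simp add: orthogonal_matrix_def)
  have "d i > 0" for i
  proof -
    let ?v = "Q *v axis i 1"
    have Qv: "transpose Q *v ?v = axis i 1"
      by (simp add: matrix_vector_mul_assoc QQ del: transpose_matrix_vector)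
    then have "?v \<noteq> 0" by (metis axis_eq_0_iff matrix_vector_mult_0_right zero_neq_one)
    from pos[OF this] have "0 < ?v \<bullet> (Q *v (?D *v axis i 1))"
      using Qv by (simp add: BQ matrix_vector_mul_assoc[symmetric] del: transpose_matrix_vector)
    also have "\<dots> = (transpose Q *v ?v) \<bullet> (?D *v axis i 1)"
      by (simp add: dot_lmul_matrix)
    also have "\<dots> = d i"
      unfolding Qv diagonal_matrix_vector_mult by (simp add: inner_axis')
    finally show ?thesis .
  qed
  with Q BQ that show thesis by blast
qed

lemma det_trace_diagonalization:
  fixes Q :: "real^'m^'m"
  assumes Q: "orthogonal_matrix Q"
  shows "det (Q ** (\<chi> i j. if i = j then d i else 0) ** transpose Q) = (\<Prod>i\<in>UNIV. d i)"
    and "trace (Q ** (\<chi> i j. if i = j then d i else 0) ** transpose Q) = (\<Sum>i\<in>UNIV. d i)"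
proof -
  let ?D = "(\<chi> i j. if i = j then d i else 0) :: real^'m^'m"
  have "det Q * det Q = 1" using det_orthogonal_matrix[OF Q] by auto
  then show "det (Q ** ?D ** transpose Q) = (\<Prod>i\<in>UNIV. d i)"
    by (simp add: det_mul det_diagonal algebra_simps)
  have "trace (Q ** ?D ** transpose Q) = trace (transpose Q ** (Q ** ?D))"
    by (rule trace_mul_sym)
  also have "\<dots> = trace ?D"
    using Q by (simp add: matrix_mul_assoc orthogonal_matrix_def)
  finally show "trace (Q ** ?D ** transpose Q) = (\<Sum>i\<in>UNIV. d i)"
    by (simp add: trace_def)
qed

lemma pos_def_det_pos:
  assumes "pos_def_matrix B"
  shows "det B > 0"
proof -
  obtain Q d where Q: "orthogonal_matrix Q"
    and B: "B = Q ** (\<chi> i j. if i = j then d i else 0) ** transpose Q" and d: "\<And>i. d i > 0"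
    using pos_def_diagonalizable[OF assms] by blast
  show ?thesis
    unfolding B det_trace_diagonalization[OF Q] by (intro prod_pos) (simp add: d)
qed

text \<open>
  With the eigenvalues \<open>d i\<close>, this is the sum of the inequalities \<open>ln (d i) \<le> d i - 1\<close>. It says
  that the likelihood of a normal sample with unit empirical covariance is largest at unit
  covariance, and it is the only inequality behind the maximum over \<open>\<Sigma>\<close>.
\<close>

lemma ln_det_le_trace:
  fixes B :: "real^'m^'m"
  assumes "pos_def_matrix B"
  shows "ln (det B) \<le> trace B - CARD('m)"
proof -
  obtain Q d where Q: "orthogonal_matrix Q"
    and B: "B = Q ** (\<chi> i j. if i = j then d i else 0) ** transpose Q" and d: "\<And>i. d i > 0"
    using pos_def_diagonalizable[OF assms] by blast
  have "ln (det B) = (\<Sum>i\<in>UNIV. ln (d i))"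
    unfolding B det_trace_diagonalization[OF Q] by (rule ln_prod) (use less_imp_neq[OF d] in auto)
  also have "\<dots> \<le> (\<Sum>i\<in>UNIV. d i - 1)" by (intro sum_mono ln_le_minus_one d)
  also have "\<dots> = trace B - CARD('m)"
    unfolding B det_trace_diagonalization[OF Q] by (simp add: sum_subtractf)
  finally show ?thesis .
qed


section \<open>Linear changes of variables for Lebesgue measure\<close>

lemma nn_integral_lborel_translate:
  fixes g :: "'a::euclidean_space \<Rightarrow> ennreal"
  assumes [measurable]: "g \<in> borel_measurable borel"
  shows "(\<integral>\<^sup>+x. g (c + x) \<partial>lborel) = (\<integral>\<^sup>+x. g x \<partial>lborel)"
proof -
  have "(\<integral>\<^sup>+x. g x \<partial>lborel) = (\<integral>\<^sup>+x. g x \<partial>distr lborel borel ((+) c))"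
    by (simp add: lborel_distr_plus)
  also have "\<dots> = (\<integral>\<^sup>+x. g (c + x) \<partial>lborel)"
    by (subst nn_integral_distr) auto
  finally show ?thesis by simp
qed

text \<open>
  The uniqueness argument for Haar measure: integrate \<open>g (T x) h (y - T x)\<close> over both variables, with
  \<open>h\<close> the indicator of the unit ball. Integrating over \<open>y\<close> first gives the left-hand side times the
  volume of the ball. Shifting \<open>x\<close> by a preimage of \<open>y\<close> and integrating over \<open>y\<close> first gives the
  right-hand side times the same volume, since \<open>T\<close> preserves the ball.
\<close>

lemma nn_integral_lborel_orthogonal:
  fixes T :: "'a::euclidean_space \<Rightarrow> 'a"
  assumes T: "orthogonal_transformation T" and g[measurable]: "g \<in> borel_measurable borel"
  shows "(\<integral>\<^sup>+x. g (T x) \<partial>lborel) = (\<integral>\<^sup>+x. g x \<partial>lborel)"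
proof -
  have lin: "linear T" using T by (rule orthogonal_transformation_linear)
  then have [measurable]: "T \<in> borel_measurable borel"
    by (intro borel_measurable_continuous_onI linear_continuous_on linear_conv_bounded_linear[THEN iffD1])
  define h :: "'a \<Rightarrow> ennreal" where "h = indicator (ball 0 1)"
  have [measurable]: "h \<in> borel_measurable borel" by (simp add: h_def borel_measurable_indicator)
  have hT: "h (T x) = h x" for x
    using orthogonal_transformation_norm[OF T, of x] by (simp add: h_def indicator_def)
  have hm: "h (- x) = h x" for x
    by (simp add: h_def indicator_def)
  define V where "V = (\<integral>\<^sup>+y. h y \<partial>lborel)"
  have V: "V = emeasure lborel (ball (0::'a) 1)" by (simp add: V_def h_def)
  have "V \<noteq> 0" "V \<noteq> \<infinity>"
    using content_ball_pos[of 1 "0::'a"] emeasure_lborel_ball_finite[of "0::'a" 1]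
    by (auto simp: V measure_def)
  have "(\<integral>\<^sup>+x. g (T x) \<partial>lborel) * V = (\<integral>\<^sup>+x. (\<integral>\<^sup>+y. g (T x) * h y \<partial>lborel) \<partial>lborel)"
    by (simp add: V_def nn_integral_cmult nn_integral_multc)
  also have "\<dots> = (\<integral>\<^sup>+x. (\<integral>\<^sup>+y. g (T x) * h (y - T x) \<partial>lborel) \<partial>lborel)"
  proof (rule nn_integral_cong)
    fix x
    show "(\<integral>\<^sup>+y. g (T x) * h y \<partial>lborel) = (\<integral>\<^sup>+y. g (T x) * h (y - T x) \<partial>lborel)"
      using nn_integral_lborel_translate[of "\<lambda>y. g (T x) * h y" "- T x"] by simp
  qed
  also have "\<dots> = (\<integral>\<^sup>+y. (\<integral>\<^sup>+x. g (T x) * h (y - T x) \<partial>lborel) \<partial>lborel)"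
    by (rule lborel_pair.Fubini') measurable
  also have "\<dots> = (\<integral>\<^sup>+y. (\<integral>\<^sup>+x. g (y + T x) * h x \<partial>lborel) \<partial>lborel)"
  proof (rule nn_integral_cong)
    fix y
    obtain z where z: "T z = y" using orthogonal_transformation_surj[OF T] by (metis surjD)
    show "(\<integral>\<^sup>+x. g (T x) * h (y - T x) \<partial>lborel) = (\<integral>\<^sup>+x. g (y + T x) * h x \<partial>lborel)"
      using nn_integral_lborel_translate[of "\<lambda>x. g (T x) * h (y - T x)" z]
      by (simp add: linear_add[OF lin] z hm hT)
  qed
  also have "\<dots> = (\<integral>\<^sup>+x. (\<integral>\<^sup>+y. g (y + T x) * h x \<partial>lborel) \<partial>lborel)"
    by (rule lborel_pair.Fubini') measurable
  also have "\<dots> = (\<integral>\<^sup>+x. (\<integral>\<^sup>+y. g y \<partial>lborel) * h x \<partial>lborel)"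
  proof (rule nn_integral_cong)
    fix x
    show "(\<integral>\<^sup>+y. g (y + T x) * h x \<partial>lborel) = (\<integral>\<^sup>+y. g y \<partial>lborel) * h x"
      using nn_integral_lborel_translate[of g "T x"] by (simp add: nn_integral_multc add.commute)
  qed
  also have "\<dots> = (\<integral>\<^sup>+y. g y \<partial>lborel) * V"
    by (simp add: V_def nn_integral_cmult)
  finally show ?thesis
    using \<open>V \<noteq> 0\<close> \<open>V \<noteq> \<infinity>\<close> by (metis infinity_ennreal_def mult_divide_eq_ennreal)
qed

text \<open>
  Every positive definite \<open>B\<close> is \<open>L L\<^sup>T\<close> for an \<open>L\<close> along which Lebesgue measure can be
  substituted with Jacobian \<open>sqrt (det B)\<close>. Taking \<open>L = Q E\<close> with \<open>Q\<close> orthogonal and \<open>E\<close> diagonal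
  reduces the change of variables to an orthogonal map and a scaling of the coordinates.
\<close>

lemma pos_def_factorization:
  fixes B :: "real^'m^'m"
  assumes B: "pos_def_matrix B"
  obtains L where "L ** transpose L = B" "det L \<noteq> 0"
    "\<And>g. g \<in> borel_measurable borel \<Longrightarrow>
       (\<integral>\<^sup>+x. g x \<partial>lborel) = ennreal (sqrt (det B)) * (\<integral>\<^sup>+x. g (L *v x) \<partial>lborel)"
proof -
  obtain Q d where Q: "orthogonal_matrix Q"
    and BQ: "B = Q ** (\<chi> i j. if i = j then d i else 0) ** transpose Q" and dpos: "\<And>i. d i > 0"
    using pos_def_diagonalizable[OF B] by blast
  let ?D = "(\<chi> i j. if i = j then d i else 0) :: real^'m^'m"
  let ?E = "(\<chi> i j. if i = j then sqrt (d i) else 0) :: real^'m^'m"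
  let ?L = "Q ** ?E"
  have DE: "?E ** ?E = ?D"
    using dpos
    by (simp add: matrix_eq matrix_vector_mul_assoc[symmetric] diagonal_matrix_vector_mult
        less_imp_le mult.assoc[symmetric])
  have tE: "transpose ?E = ?E" by (auto simp: vec_eq_iff transpose_def)
  have L: "?L ** transpose ?L = B"
  proof -
    have "?L ** transpose ?L = Q ** (?E ** transpose ?E) ** transpose Q"
      by (simp only: matrix_transpose_mul matrix_mul_assoc)
    then show ?thesis by (simp only: tE DE BQ)
  qed
  have sqrt_pos: "(\<Prod>i\<in>UNIV. sqrt (d i)) > 0" by (intro prod_pos) (simp add: dpos)
  have "det B = (\<Prod>i\<in>UNIV. sqrt (d i))\<^sup>2"
    unfolding BQ det_trace_diagonalization[OF Q]
    using dpos by (simp add: prod_power_distrib less_imp_le)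
  then have sqrtB: "sqrt (det B) = (\<Prod>i\<in>UNIV. sqrt (d i))"
    using sqrt_pos by (metis less_imp_le real_sqrt_unique)
  have "(det ?L)\<^sup>2 = det B"
    unfolding L[symmetric] by (simp only: det_mul det_transpose power2_eq_square)
  then have detL: "det ?L \<noteq> 0" using pos_def_det_pos[OF B] by auto
  have int: "(\<integral>\<^sup>+x. g x \<partial>lborel) = ennreal (sqrt (det B)) * (\<integral>\<^sup>+x. g (?L *v x) \<partial>lborel)"
    if [measurable]: "g \<in> borel_measurable borel" for g
  proof -
    have mv[measurable]: "(\<lambda>x. M *v x) \<in> borel_measurable borel" for M :: "real^'m^'m"
      by (intro borel_measurable_continuous_onI linear_continuous_on matrix_vector_mul_bounded_linear)
    have T: "orthogonal_transformation ((*v) Q)"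
      using Q by (simp add: orthogonal_transformation_matrix)
    \<comment> \<open>the scale factors of \<open>E\<close>, indexed by the basis vectors \<open>axis i 1\<close>\<close>
    define c :: "real^'m \<Rightarrow> real" where "c b = sqrt (d (SOME i. b = axis i 1))" for b
    have ca: "c (axis i 1) = sqrt (d i)" for i
      by (simp add: c_def axis_eq_axis)
    have "c j \<noteq> 0" if "j \<in> Basis" for j
      using less_imp_neq[OF dpos] by (simp add: c_def)
    note aff = lborel_affine_euclidean[of c 0, OF this]
    have BV: "(Basis :: (real^'m) set) = range (\<lambda>i. axis i 1)"
      by (auto simp: Basis_vec_def)
    have inj: "inj (\<lambda>i. axis i 1 :: real^'m)"
      by (simp add: inj_on_def axis_eq_axis)
    have Tc: "0 + (\<Sum>j\<in>Basis. (c j * (x \<bullet> j)) *\<^sub>R j) = ?E *v x" for x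
    proof -
      have "0 + (\<Sum>j\<in>Basis. (c j * (x \<bullet> j)) *\<^sub>R j) = (\<Sum>i\<in>UNIV. (sqrt (d i) * x $ i) *\<^sub>R axis i 1)"
        by (simp add: BV sum.reindex[OF inj] ca inner_axis)
      also have "\<dots> = ?E *v x"
        unfolding diagonal_matrix_vector_mult
        by (simp add: vec_eq_iff axis_def if_distrib[of "\<lambda>z. _ * z"] cong: if_cong)
      finally show ?thesis .
    qed
    have pc: "(\<Prod>j\<in>Basis. \<bar>c j\<bar>) = sqrt (det B)"
      using dpos by (simp add: BV prod.reindex[OF inj] ca sqrtB less_imp_le)
    have "(\<integral>\<^sup>+x. g x \<partial>lborel) = (\<integral>\<^sup>+x. g (Q *v x) \<partial>lborel)"
      using nn_integral_lborel_orthogonal[OF T that] by simp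
    also have "\<dots> = (\<integral>\<^sup>+x. g (Q *v x) \<partial>density (distr lborel borel ((*v) ?E)) (\<lambda>_. ennreal (sqrt (det B))))"
      using aff unfolding Tc pc by simp
    also have "\<dots> = ennreal (sqrt (det B)) * (\<integral>\<^sup>+x. g (?L *v x) \<partial>lborel)"
      by (simp add: nn_integral_density nn_integral_distr nn_integral_cmult matrix_vector_mul_assoc)
    finally show ?thesis .
  qed
  show thesis by (rule that[OF L detL int])
qed

section \<open>The integral over one observation\<close>

lemma borel_measurable_det:
  fixes F :: "'a \<Rightarrow> real^'m^'m"
  assumes [measurable]: "\<And>i j. (\<lambda>x. F x $ i $ j) \<in> borel_measurable M"
  shows "(\<lambda>x. det (F x)) \<in> borel_measurable M"
  unfolding det_def by measurable

lemma outer_mult_vec: "outer u v *v x = (v \<bullet> x) *\<^sub>R u"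
  by (simp add: vec_eq_iff outer_def matrix_vector_mult_def inner_vec_def sum_distrib_right
      sum_distrib_left mult_ac)

lemma outer_matrix_mult: "outer (M *v u) (M *v v) = M ** outer u v ** transpose M"
  for M :: "real^'m^'m"
  by (simp add: matrix_eq matrix_vector_mul_assoc[symmetric] outer_mult_vec matrix_vector_mult_scaleR)
    (metis dot_lmul_matrix inner_commute)

lemma matrix_mult_scaleR_right: "A ** (c *\<^sub>R B) = c *\<^sub>R (A ** B)" for A B :: "real^'m^'m"
  by (simp add: vec_eq_iff matrix_matrix_mult_def sum_distrib_left mult_ac)

lemma matrix_mult_scaleR_left: "(c *\<^sub>R A) ** B = c *\<^sub>R (A ** B)" for A B :: "real^'m^'m"
  by (simp add: vec_eq_iff matrix_matrix_mult_def sum_distrib_left mult_ac)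

lemma det_congruence: "det (M ** A ** transpose M) = (det M)\<^sup>2 * det A"
  for A M :: "real^'m^'m"
  by (simp add: det_mul power2_eq_square)

lemma matrix_add_rdistrib: "(A + B) ** C = A ** C + B ** C" for A B C :: "real^'m^'m"
  by (simp add: vec_eq_iff matrix_matrix_mult_def sum.distrib ring_distribs)

lemma congruence_plus_outer:
  "M ** (A + d *\<^sub>R outer u u) ** transpose M = M ** A ** transpose M + d *\<^sub>R outer (M *v u) (M *v u)"
  for A M :: "real^'m^'m"
  by (simp add: outer_matrix_mult matrix_add_ldistrib matrix_add_rdistrib
      matrix_mult_scaleR_right matrix_mult_scaleR_left)

text \<open>
  A rotation takes \<open>u\<close> to a multiple of a coordinate axis, where the matrix becomes diagonal.
\<close>

lemma det_identity_plus_outer: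
  fixes u :: "real^'m"
  shows "det (mat 1 + d *\<^sub>R outer u u) = 1 + d * (u \<bullet> u)"
proof -
  fix k :: 'm
  let ?w = "norm u *\<^sub>R axis k 1 :: real^'m"
  have "norm ?w = norm u" by simp
  then obtain f where f: "orthogonal_transformation f" "f ?w = u"
    using orthogonal_transformation_exists by blast
  define Q where "Q = matrix f"
  have Q: "orthogonal_matrix Q" and fQ: "f = (*v) Q"
    using f by (auto simp: Q_def orthogonal_transformation_matrix)
  have "mat 1 + d *\<^sub>R outer u u = Q ** (mat 1 + d *\<^sub>R outer ?w ?w) ** transpose Q"
    using Q f(2) by (simp add: congruence_plus_outer orthogonal_matrix_def fQ)
  then have "det (mat 1 + d *\<^sub>R outer u u) = (det Q)\<^sup>2 * det (mat 1 + d *\<^sub>R outer ?w ?w)"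
    by (simp add: det_congruence)
  also have "(det Q)\<^sup>2 = 1"
    using det_orthogonal_matrix[OF Q] by auto
  also have "det (mat 1 + d *\<^sub>R outer ?w ?w) = (\<Prod>i\<in>UNIV. if i = k then 1 + d * (norm u)\<^sup>2 else 1)"
  proof (subst det_diagonal)
    show "(mat 1 + d *\<^sub>R outer ?w ?w) $ i $ j = 0" if "i \<noteq> j" for i j
      using that by (auto simp: mat_def outer_def axis_def)
    show "(\<Prod>i\<in>UNIV. (mat 1 + d *\<^sub>R outer ?w ?w) $ i $ i) = (\<Prod>i\<in>UNIV. if i = k then 1 + d * (norm u)\<^sup>2 else 1)"
      by (rule prod.cong) (auto simp: mat_def outer_def axis_def power2_eq_square)
  qed
  also have "\<dots> = 1 + d * (u \<bullet> u)"
    by (simp add: power2_norm_eq_inner)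
  finally show ?thesis by simp
qed

lemma nn_integral_Gamma_scaled:
  fixes a s :: real
  assumes a: "a > 0" and s: "s > 0"
  shows "(\<integral>\<^sup>+t. ennreal (indicator {0..} t * t powr (a - 1) * exp (- (s * t))) \<partial>lborel)
    = ennreal (Gamma a * s powr - a)"
proof -
  let ?I = "\<integral>\<^sup>+t. ennreal (indicator {0..} t * t powr (a - 1) * exp (- (s * t))) \<partial>lborel"
  have "ennreal (Gamma a) = (\<integral>\<^sup>+t. ennreal (indicator {0..} t * t powr (a - 1) / exp t) \<partial>lborel)"
    by (rule Gamma_conv_nn_integral_real[OF a])
  also have "\<dots> = ennreal s * (\<integral>\<^sup>+t. ennreal (indicator {0..} (s * t) * (s * t) powr (a - 1) / exp (s * t)) \<partial>lborel)"
    using s by (subst nn_integral_real_affine[where c = s and t = 0]) auto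
  also have "(\<integral>\<^sup>+t. ennreal (indicator {0..} (s * t) * (s * t) powr (a - 1) / exp (s * t)) \<partial>lborel) =
      (\<integral>\<^sup>+t. ennreal (s powr (a - 1)) * ennreal (indicator {0..} t * t powr (a - 1) * exp (- (s * t))) \<partial>lborel)"
    using s by (intro nn_integral_cong)
      (auto simp: ennreal_mult'[symmetric] powr_mult exp_minus field_simps zero_le_mult_iff split: split_indicator)
  also have "\<dots> = ennreal (s powr (a - 1)) * ?I"
    by (rule nn_integral_cmult) measurable
  finally have "ennreal (Gamma a) = ennreal (s powr a) * ?I"
    using s by (simp add: mult.assoc[symmetric] ennreal_mult'[symmetric] powr_diff)
  then have "ennreal (s powr - a) * ennreal (Gamma a) = (ennreal (s powr - a) * ennreal (s powr a)) * ?I"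
    by (simp add: mult.assoc)
  also have "ennreal (s powr - a) * ennreal (s powr a) = 1"
    using s by (simp add: ennreal_mult'[symmetric] powr_add[symmetric])
  finally show ?thesis
    using a by (simp add: ennreal_mult'[symmetric] Gamma_real_pos mult.commute)
qed

lemma nn_integral_gaussian_real:
  fixes t :: real
  assumes t: "t > 0"
  shows "(\<integral>\<^sup>+x. ennreal (exp (- (t * x\<^sup>2))) \<partial>lborel) = ennreal (sqrt (pi / t))"
proof -
  define \<sigma> where "\<sigma> = sqrt (1 / (2 * t))"
  have s: "\<sigma> > 0" "\<sigma>\<^sup>2 = 1 / (2 * t)" using t by (auto simp: \<sigma>_def)
  have *: "exp (- (t * x\<^sup>2)) = sqrt (pi / t) * normal_density 0 \<sigma> x" for x
  proof -
    have "2 * pi * \<sigma>\<^sup>2 = pi / t" "- (x - 0)\<^sup>2 / (2 * \<sigma>\<^sup>2) = - (t * x\<^sup>2)"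
      using t by (auto simp: s(2))
    then have "normal_density 0 \<sigma> x = 1 / sqrt (pi / t) * exp (- (t * x\<^sup>2))"
      by (simp only: normal_density_def)
    moreover have "sqrt (pi / t) \<noteq> 0" using t by simp
    ultimately show ?thesis by simp
  qed
  have "(\<integral>\<^sup>+x. ennreal (exp (- (t * x\<^sup>2))) \<partial>lborel)
    = (\<integral>\<^sup>+x. ennreal (sqrt (pi / t)) * ennreal (normal_density 0 \<sigma> x) \<partial>lborel)"
    using t by (simp add: * ennreal_mult')
  also have "\<dots> = ennreal (sqrt (pi / t)) * (\<integral>\<^sup>+x. ennreal (normal_density 0 \<sigma> x) \<partial>lborel)"
    by (rule nn_integral_cmult) measurable
  also have "(\<integral>\<^sup>+x. ennreal (normal_density 0 \<sigma> x) \<partial>lborel) = 1"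
    using s integral_normal_density[of \<sigma> 0] integrable_normal_density[of \<sigma> 0]
    by (subst nn_integral_eq_integral) auto
  finally show ?thesis by simp
qed

lemma nn_integral_gaussian_vec:
  fixes t :: real
  assumes t: "t > 0"
  shows "(\<integral>\<^sup>+u. ennreal (exp (- (t * (u \<bullet> u)))) \<partial>(lborel :: 'a::euclidean_space measure))
    = ennreal (t powr - (DIM('a) / 2) * pi powr (DIM('a) / 2))"
proof -
  have "(\<integral>\<^sup>+u. ennreal (exp (- (t * (u \<bullet> u)))) \<partial>(lborel :: 'a measure))
    = (\<integral>\<^sup>+u. (\<Prod>b\<in>Basis. ennreal (exp (- (t * (u \<bullet> b)\<^sup>2)))) \<partial>(lborel :: 'a measure))"
    by (intro nn_integral_cong)
      (simp add: euclidean_inner[of x x for x] prod_ennreal exp_sum[symmetric] sum_distrib_left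
        sum_negf power2_eq_square)
  also have "\<dots> = (\<Prod>b\<in>(Basis::'a set). \<integral>\<^sup>+x. ennreal (exp (- (t * x\<^sup>2))) \<partial>lborel)"
    by (rule nn_integral_lborel_prod) auto
  also have "\<dots> = ennreal (sqrt (pi / t) ^ DIM('a))"
    using t by (simp add: nn_integral_gaussian_real ennreal_power)
  also have "sqrt (pi / t) ^ DIM('a) = (pi / t) powr (DIM('a) / 2)"
    using t by (simp add: powr_half_sqrt[symmetric] powr_realpow[symmetric] powr_powr)
  also have "\<dots> = t powr - (DIM('a) / 2) * pi powr (DIM('a) / 2)"
    using t by (simp add: powr_divide powr_minus field_simps)
  finally show ?thesis .
qed

text \<open>
  Writing \<open>(1 + q) powr - a\<close> as a Gamma integral of \<open>exp (- (1 + q) t)\<close> turns the inner integral over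
  \<open>u\<close> into a Gaussian one, which contributes the factor \<open>t powr - (DIM('a) / 2)\<close> that lowers the
  argument of \<open>Gamma\<close>. This is where \<open>a > DIM('a) / 2\<close> is needed for convergence.
\<close>

lemma nn_integral_radial_power:
  fixes a d :: real
  assumes d: "d > 0" and a: "a > DIM('a) / 2"
  shows "(\<integral>\<^sup>+u. ennreal ((1 + d * (u \<bullet> u)) powr - a) \<partial>(lborel :: 'a::euclidean_space measure))
    = ennreal (d powr - (DIM('a) / 2) * (pi powr (DIM('a) / 2) * Gamma (a - DIM('a) / 2) / Gamma a))"
proof -
  let ?m = "real DIM('a)"
  have a0: "a > 0" using a by (rule le_less_trans[rotated]) simp
  have Ga: "Gamma a > 0" by (rule Gamma_real_pos[OF a0])
  let ?F = "\<lambda>(u::'a) t. ennreal (indicator {0..} t * t powr (a - 1) * exp (- ((1 + d * (u \<bullet> u)) * t)))"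
  let ?J = "\<integral>\<^sup>+u. ennreal ((1 + d * (u \<bullet> u)) powr - a) \<partial>(lborel :: 'a measure)"
  have "ennreal (Gamma a) * ?J = (\<integral>\<^sup>+u. ennreal (Gamma a) * ennreal ((1 + d * (u \<bullet> u)) powr - a) \<partial>(lborel :: 'a measure))"
    by (rule nn_integral_cmult[symmetric]) measurable
  also have "\<dots> = (\<integral>\<^sup>+u. (\<integral>\<^sup>+t. ?F u t \<partial>lborel) \<partial>(lborel :: 'a measure))"
  proof (rule nn_integral_cong)
    fix u :: 'a
    have "1 + d * (u \<bullet> u) > 0" using d by (intro add_pos_nonneg mult_nonneg_nonneg) auto
    then show "ennreal (Gamma a) * ennreal ((1 + d * (u \<bullet> u)) powr - a) = (\<integral>\<^sup>+t. ?F u t \<partial>lborel)"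
      using nn_integral_Gamma_scaled[OF a0] Ga by (simp add: ennreal_mult')
  qed
  also have "\<dots> = (\<integral>\<^sup>+t. (\<integral>\<^sup>+u. ?F u t \<partial>(lborel :: 'a measure)) \<partial>lborel)"
    by (rule pair_sigma_finite.Fubini'[symmetric]) (unfold_locales, measurable)
  also have "\<dots> = (\<integral>\<^sup>+t. ennreal (d powr - (?m / 2) * pi powr (?m / 2)) *
      ennreal (indicator {0..} t * t powr ((a - ?m / 2) - 1) * exp (- (1 * t))) \<partial>lborel)"
  proof (rule nn_integral_cong)
    fix t :: real
    show "(\<integral>\<^sup>+u. ?F u t \<partial>(lborel :: 'a measure)) = ennreal (d powr - (?m / 2) * pi powr (?m / 2)) *
      ennreal (indicator {0..} t * t powr ((a - ?m / 2) - 1) * exp (- (1 * t)))"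
    proof (cases "t > 0")
      case True
      have "(\<integral>\<^sup>+u. ?F u t \<partial>(lborel :: 'a measure)) =
        (\<integral>\<^sup>+u. ennreal (t powr (a - 1) * exp (- t)) * ennreal (exp (- ((d * t) * (u \<bullet> u)))) \<partial>(lborel :: 'a measure))"
        using True by (intro nn_integral_cong)
          (simp add: ennreal_mult'[symmetric] algebra_simps mult_exp_exp)
      also have "\<dots> = ennreal (t powr (a - 1) * exp (- t)) * ennreal ((d * t) powr - (?m / 2) * pi powr (?m / 2))"
        using True d by (subst nn_integral_cmult) (auto simp: nn_integral_gaussian_vec)
      also have "\<dots> = ennreal (d powr - (?m / 2) * pi powr (?m / 2)) *
        ennreal (indicator {0..} t * t powr ((a - ?m / 2) - 1) * exp (- (1 * t)))"
      proof -
        have "t powr ((a - ?m / 2) - 1) = t powr (a - 1) * t powr - (?m / 2)"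
          by (simp add: powr_add[symmetric] algebra_simps)
        then show ?thesis
          using True d by (simp add: ennreal_mult'[symmetric] powr_mult mult_ac)
      qed
      finally show ?thesis .
    next
      case False
      then show ?thesis by (cases "t = 0") simp_all
    qed
  qed
  also have "\<dots> = ennreal (d powr - (?m / 2) * pi powr (?m / 2)) * ennreal (Gamma (a - ?m / 2))"
    using a nn_integral_Gamma_scaled[of "a - ?m / 2" 1] by (subst nn_integral_cmult) auto
  finally have "ennreal (Gamma a) * ?J = ennreal (d powr - (?m / 2) * pi powr (?m / 2) * Gamma (a - ?m / 2))"
    by (simp add: ennreal_mult')
  then have "?J = ennreal (d powr - (?m / 2) * pi powr (?m / 2) * Gamma (a - ?m / 2)) / ennreal (Gamma a)"
    using Ga mult_divide_eq_ennreal[of "ennreal (Gamma a)" ?J] by (simp add: mult.commute)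
  also have "\<dots> = ennreal (d powr - (?m / 2) * pi powr (?m / 2) * Gamma (a - ?m / 2) / Gamma a)"
    using Ga a by (intro divide_ennreal) (auto intro!: mult_nonneg_nonneg less_imp_le Gamma_real_pos)
  finally show ?thesis by (simp add: mult_ac)
qed

text \<open>
  Integrating one observation out. With \<open>B = L L\<^sup>T\<close> and \<open>y = v + L u\<close> the determinant becomes
  \<open>det B (1 + d |u|\<^sup>2)\<close>. The Jacobian \<open>sqrt (det B)\<close> raises the power of \<open>det B\<close> by one half, so
  the result is again a power of a determinant and the next observation can be integrated out.
\<close>

lemma nn_integral_det_rank_one_update:
  fixes B :: "real^'m^'m"
  assumes B: "pos_def_matrix B" and d: "d > 0" and a: "a > CARD('m) / 2"
  shows "(\<integral>\<^sup>+y. ennreal (det (B + d *\<^sub>R outer (y - v) (y - v)) powr - a) \<partial>lborel)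
    = ennreal (det B powr - (a - 1/2) * d powr - (CARD('m) / 2) *
        (pi powr (CARD('m) / 2) * Gamma (a - CARD('m) / 2) / Gamma a))"
proof -
  obtain L where L: "L ** transpose L = B" "det L \<noteq> 0" and
    int: "\<And>g. g \<in> borel_measurable borel \<Longrightarrow>
       (\<integral>\<^sup>+x. g x \<partial>lborel) = ennreal (sqrt (det B)) * (\<integral>\<^sup>+x. g (L *v x) \<partial>lborel)"
    using pos_def_factorization[OF B] by metis
  have pos: "0 < det B" using B by (rule pos_def_det_pos)
  have meas[measurable]: "(\<lambda>y. det (B + d *\<^sub>R outer (y - w) (y - w))) \<in> borel_measurable borel" for w
    by (intro borel_measurable_det) (simp add: outer_def)
  have "(\<integral>\<^sup>+y. ennreal (det (B + d *\<^sub>R outer (y - v) (y - v)) powr - a) \<partial>lborel)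
    = (\<integral>\<^sup>+y. ennreal (det (B + d *\<^sub>R outer y y) powr - a) \<partial>lborel)"
    by (subst nn_integral_lborel_translate[of _ v, symmetric]) simp_all
  also have "\<dots> = ennreal (sqrt (det B)) * (\<integral>\<^sup>+u. ennreal (det (B + d *\<^sub>R outer (L *v u) (L *v u)) powr - a) \<partial>lborel)"
    using meas[of 0] by (intro int) simp
  also have "(\<integral>\<^sup>+u. ennreal (det (B + d *\<^sub>R outer (L *v u) (L *v u)) powr - a) \<partial>lborel)
    = (\<integral>\<^sup>+u. ennreal (det B powr - a) * ennreal ((1 + d * (u \<bullet> u)) powr - a) \<partial>(lborel :: (real^'m) measure))"
  proof (rule nn_integral_cong)
    fix u :: "real^'m"
    have "B + d *\<^sub>R outer (L *v u) (L *v u) = L ** (mat 1 + d *\<^sub>R outer u u) ** transpose L"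
      by (simp add: congruence_plus_outer L)
    then have "det (B + d *\<^sub>R outer (L *v u) (L *v u)) = (det L)\<^sup>2 * (1 + d * (u \<bullet> u))"
      by (simp only: det_congruence det_identity_plus_outer)
    also have "(det L)\<^sup>2 = det B" unfolding L(1)[symmetric] by (simp add: det_mul power2_eq_square)
    finally have eq: "det (B + d *\<^sub>R outer (L *v u) (L *v u)) = det B * (1 + d * (u \<bullet> u))" .
    have "1 + d * (u \<bullet> u) > 0" using d by (intro add_pos_nonneg mult_nonneg_nonneg) auto
    then show "ennreal (det (B + d *\<^sub>R outer (L *v u) (L *v u)) powr - a) =
        ennreal (det B powr - a) * ennreal ((1 + d * (u \<bullet> u)) powr - a)"
      unfolding eq using pos by (simp add: powr_mult ennreal_mult')
  qed
  also have "\<dots> = ennreal (det B powr - a) * ennreal (d powr - (CARD('m) / 2) *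
        (pi powr (CARD('m) / 2) * Gamma (a - CARD('m) / 2) / Gamma a))"
    using nn_integral_radial_power[where 'a = "real^'m", OF d, of a] a
    by (subst nn_integral_cmult) auto
  also have "ennreal (sqrt (det B)) * \<dots> = ennreal (sqrt (det B) * det B powr - a * (d powr - (CARD('m) / 2) *
        (pi powr (CARD('m) / 2) * Gamma (a - CARD('m) / 2) / Gamma a)))"
    using pos by (simp only: ennreal_mult' mult.assoc real_sqrt_ge_zero less_imp_le powr_ge_zero)
  also have "sqrt (det B) * det B powr - a = det B powr - (a - 1/2)"
    using pos by (simp add: powr_half_sqrt[symmetric] powr_add[symmetric])
  finally show ?thesis by (simp add: mult.assoc)
qed

section \<open>Scatter matrices and the integral over all observations\<close>

text \<open>
  \<open>B\<close> plus the scatter matrix of the observations \<open>y i\<close>, with the correction for the mean taken with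
  a weight \<open>1 / K\<close>. For \<open>K = card S\<close> this would be the scatter about the empirical mean; the prior on
  the mean makes \<open>K\<close> larger. Up to a factor, the MAP covariance is of this form, and so are all
  matrices that arise by integrating observations out.
\<close>

definition scatter :: "real^'m^'m \<Rightarrow> 'i set \<Rightarrow> real \<Rightarrow> ('i \<Rightarrow> real^'m) \<Rightarrow> real^'m^'m"
  where "scatter B S K y =
    B + (\<Sum>i\<in>S. outer (y i) (y i)) - (1 / K) *\<^sub>R outer (\<Sum>i\<in>S. y i) (\<Sum>i\<in>S. y i)"

lemma scatter_component:
  "scatter B S K y $ p $ q =
    B $ p $ q + (\<Sum>i\<in>S. y i $ p * y i $ q) - (\<Sum>i\<in>S. y i $ p) * (\<Sum>i\<in>S. y i $ q) / K"
  by (simp add: scatter_def outer_def)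

lemma scatter_empty: "scatter B {} K y = B"
  by (simp add: vec_eq_iff scatter_component)

lemma scatter_cong: "(\<And>i. i \<in> S \<Longrightarrow> y i = z i) \<Longrightarrow> scatter B S K y = scatter B S K z"
  by (simp add: scatter_def)

lemma scatter_quadratic_form:
  fixes v :: "real^'m" and y :: "'i \<Rightarrow> real^'m"
  shows "v \<bullet> (scatter B S K y *v v) =
    v \<bullet> (B *v v) + (\<Sum>i\<in>S. (y i \<bullet> v)\<^sup>2) - (\<Sum>i\<in>S. y i \<bullet> v)\<^sup>2 / K"
proof -
  have sum_mult: "(\<Sum>i\<in>S. A i) *v v = (\<Sum>i\<in>S. A i *v v)" for A :: "'i \<Rightarrow> real^'m^'m"
    by (induction S rule: infinite_finite_induct) (simp_all add: matrix_vector_mult_add_rdistrib)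
  show ?thesis
    by (simp add: scatter_def matrix_vector_mult_add_rdistrib matrix_vector_mult_diff_rdistrib
        sum_mult outer_mult_vec scaleR_matrix_vector_assoc[symmetric] inner_add_right
        inner_diff_right inner_sum_right inner_sum_left inner_commute[of v] power2_eq_square)
qed

text \<open>
  By the Cauchy-Schwarz inequality the correction for the mean does not exceed the scatter.
\<close>

lemma pos_def_scatter:
  fixes B :: "real^'m^'m"
  assumes B: "pos_def_matrix B" and S: "finite S" and K: "K > real (card S)"
  shows "pos_def_matrix (scatter B S K y)"
  unfolding pos_def_matrix_def
proof (intro conjI allI impI)
  have "B $ q $ p = B $ p $ q" for p q
    using B by (simp add: pos_def_matrix_def transpose_def vec_eq_iff)
  then show "transpose (scatter B S K y) = scatter B S K y"
    by (simp add: vec_eq_iff transpose_def scatter_component mult.commute)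
  fix v :: "real^'m" assume v: "v \<noteq> 0"
  have K0: "K > 0" using K by (rule le_less_trans[rotated]) simp
  have "(\<Sum>i\<in>S. y i \<bullet> v)\<^sup>2 \<le> (\<Sum>i\<in>S. (y i \<bullet> v)\<^sup>2) * card S"
    by (rule sum_squared_le_sum_of_squares)
  also have "\<dots> \<le> (\<Sum>i\<in>S. (y i \<bullet> v)\<^sup>2) * K"
    using K by (intro mult_left_mono sum_nonneg) auto
  finally have "(\<Sum>i\<in>S. y i \<bullet> v)\<^sup>2 / K \<le> (\<Sum>i\<in>S. (y i \<bullet> v)\<^sup>2)"
    using K0 by (simp add: pos_divide_le_eq)
  moreover have "v \<bullet> (B *v v) > 0" using B v by (simp add: pos_def_matrix_def)
  ultimately show "0 < v \<bullet> (scatter B S K y *v v)"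
    by (simp add: scatter_quadratic_form)
qed

text \<open>
  Completing the square in the observation \<open>y k\<close>: what remains after removing it is a matrix of the
  same form for \<open>S\<close>, with \<open>K\<close> replaced by \<open>K - 1\<close>. This makes the induction over \<open>S\<close> possible without
  any change of variables that mixes the observations.
\<close>

lemma scatter_insert:
  assumes S: "finite S" "k \<notin> S" and K: "K > 1"
  shows "scatter B (insert k S) K y = scatter B S (K - 1) y
    + (1 - 1 / K) *\<^sub>R outer (y k - (1 / (K - 1)) *\<^sub>R (\<Sum>i\<in>S. y i)) (y k - (1 / (K - 1)) *\<^sub>R (\<Sum>i\<in>S. y i))"
proof -
  have *: "a + (u * v + c) - (u + s) * (v + t) / K
      = a + c - s * t / (K - 1) + (1 - 1 / K) * ((u - s / (K - 1)) * (v - t / (K - 1)))"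
    for a u v c s t :: real
  proof -
    have "K \<noteq> 0" "K - 1 \<noteq> 0" using K by auto
    then show ?thesis by (simp add: divide_simps) algebra
  qed
  show ?thesis
    using S by (simp add: vec_eq_iff scatter_component outer_def *)
qed

lemma borel_measurable_det_scatter:
  fixes B :: "real^'m^'m"
  shows "(\<lambda>y. det (scatter B S K y)) \<in> borel_measurable (PiM S (\<lambda>_. lborel))"
proof (intro borel_measurable_det)
  fix p q :: 'm
  have [measurable]: "(\<lambda>y. (y i :: real^'m) $ p) \<in> borel_measurable (PiM S (\<lambda>_. lborel))" if "i \<in> S" for i and p :: 'm
  proof -
    have "(\<lambda>y. y i) \<in> PiM S (\<lambda>_. lborel) \<rightarrow>\<^sub>M (lborel :: (real^'m) measure)"
      using that by (rule measurable_component_singleton)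
    moreover have "(\<lambda>v :: real^'m. v $ p) \<in> borel_measurable lborel"
      by (simp add: borel_measurable_continuous_onI continuous_intros)
    ultimately show ?thesis by (rule measurable_compose)
  qed
  show "(\<lambda>y. scatter B S K y $ p $ q) \<in> borel_measurable (PiM S (\<lambda>_. lborel))"
    unfolding scatter_component by measurable
qed

text \<open>
  Removing an observation lowers \<open>K\<close> by 1 and \<open>a\<close> by 1/2. The factors \<open>1 - 1 / K\<close> left over by the
  successive steps telescope to \<open>(K - card S) / K\<close>. The lower bound on \<open>a\<close> is what the last step
  needs.
\<close>

lemma nn_integral_det_scatter:
  fixes B :: "real^'m^'m" and K a :: real
  assumes "finite S" "pos_def_matrix B" "K > real (card S)" "a > (real (card S) - 1 + CARD('m)) / 2"
  shows "(\<integral>\<^sup>+y. ennreal (det (scatter B S K y) powr - a) \<partial>PiM S (\<lambda>_. lborel))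
    = ennreal (det B powr - (a - card S / 2) * ((K - card S) / K) powr - (CARD('m) / 2) *
        (\<Prod>k<card S. pi powr (CARD('m) / 2) * Gamma (a - real k / 2 - CARD('m) / 2) / Gamma (a - real k / 2)))"
  using assms
proof (induction S arbitrary: K a rule: finite_induct)
  case empty
  interpret product_sigma_finite "\<lambda>_::'a. lborel :: (real^'m) measure" by unfold_locales
  show ?case using empty by (simp add: PiM_empty nn_integral_count_space_finite scatter_empty)
next
  case (insert k S)
  interpret product_sigma_finite "\<lambda>_::'a. lborel :: (real^'m) measure" by unfold_locales
  let ?m = "real CARD('m)"
  let ?s = "real (card S)"
  define G where "G b = pi powr (?m / 2) * Gamma (b - ?m / 2) / Gamma b" for b
  define d where "d = 1 - 1 / K"
  have K: "K > 1" "K - 1 > ?s" using insert by auto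
  have d: "d > 0" using K by (simp add: d_def)
  have a: "a > ?m / 2" "a - 1/2 > (?s - 1 + ?m) / 2" using insert by (auto simp: field_simps)
  have meas: "(\<lambda>y. ennreal (det (scatter B (insert k S) K y) powr - a)) \<in> borel_measurable (PiM (insert k S) (\<lambda>_. lborel))"
    by (rule measurable_compose[OF borel_measurable_det_scatter]) measurable
  have "(\<integral>\<^sup>+y. ennreal (det (scatter B (insert k S) K y) powr - a) \<partial>PiM (insert k S) (\<lambda>_. lborel))
    = (\<integral>\<^sup>+x. (\<integral>\<^sup>+y. ennreal (det (scatter B (insert k S) K (x(k := y))) powr - a) \<partial>lborel) \<partial>PiM S (\<lambda>_. lborel))"
    by (rule product_nn_integral_insert[OF insert.hyps meas])
  also have "\<dots> = (\<integral>\<^sup>+x. ennreal (d powr - (?m / 2) * G a) * ennreal (det (scatter B S (K - 1) x) powr - (a - 1/2)) \<partial>PiM S (\<lambda>_. lborel))"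
  proof (rule nn_integral_cong)
    fix x :: "'a \<Rightarrow> real^'m"
    have "scatter B (insert k S) K (x(k := y)) = scatter B S (K - 1) x
      + d *\<^sub>R outer (y - (1 / (K - 1)) *\<^sub>R (\<Sum>i\<in>S. x i)) (y - (1 / (K - 1)) *\<^sub>R (\<Sum>i\<in>S. x i))" for y
    proof -
      have eq: "(x(k := y)) i = x i" if "i \<in> S" for i
        using that insert.hyps by auto
      have "(\<Sum>i\<in>S. (x(k := y)) i) = (\<Sum>i\<in>S. x i)"
        by (rule sum.cong[OF refl eq])
      moreover have "scatter B S (K - 1) (x(k := y)) = scatter B S (K - 1) x"
        by (rule scatter_cong[OF eq])
      moreover have "(x(k := y)) k = y" by simp
      ultimately show ?thesis
        unfolding d_def by (metis scatter_insert[OF insert.hyps K(1)])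
    qed
    then show "(\<integral>\<^sup>+y. ennreal (det (scatter B (insert k S) K (x(k := y))) powr - a) \<partial>lborel)
      = ennreal (d powr - (?m / 2) * G a) * ennreal (det (scatter B S (K - 1) x) powr - (a - 1/2))"
      using nn_integral_det_rank_one_update[OF pos_def_scatter[OF insert.prems(1) insert.hyps(1) K(2)] d a(1)]
      unfolding ennreal_mult''[OF powr_ge_zero, symmetric] by (simp add: G_def mult_ac)
  qed
  also have "\<dots> = ennreal (d powr - (?m / 2) * G a) *
     (\<integral>\<^sup>+x. ennreal (det (scatter B S (K - 1) x) powr - (a - 1/2)) \<partial>PiM S (\<lambda>_. lborel))"
    by (intro nn_integral_cmult measurable_compose[OF borel_measurable_det_scatter]) measurable
  also have "(\<integral>\<^sup>+x. ennreal (det (scatter B S (K - 1) x) powr - (a - 1/2)) \<partial>PiM S (\<lambda>_. lborel))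
    = ennreal (det B powr - (a - 1/2 - ?s / 2) * ((K - 1 - ?s) / (K - 1)) powr - (?m / 2) * (\<Prod>k<card S. G (a - 1/2 - real k / 2)))"
    using insert.IH[OF insert.prems(1) K(2) a(2)] by (simp add: G_def algebra_simps)
  also have "ennreal (d powr - (?m / 2) * G a) * \<dots> = ennreal ((d powr - (?m / 2) * G a) *
     (det B powr - (a - 1/2 - ?s / 2) * ((K - 1 - ?s) / (K - 1)) powr - (?m / 2) * (\<Prod>k<card S. G (a - 1/2 - real k / 2))))"
    using a by (intro ennreal_mult'[symmetric]) (auto simp: G_def intro!: mult_nonneg_nonneg divide_nonneg_nonneg less_imp_le[OF Gamma_real_pos])
  also have "(d powr - (?m / 2) * G a) *
     (det B powr - (a - 1/2 - ?s / 2) * ((K - 1 - ?s) / (K - 1)) powr - (?m / 2) * (\<Prod>k<card S. G (a - 1/2 - real k / 2)))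
     = det B powr - (a - 1/2 - ?s / 2) * (d powr - (?m / 2) * ((K - 1 - ?s) / (K - 1)) powr - (?m / 2)) * (G a * (\<Prod>k<card S. G (a - 1/2 - real k / 2)))"
    by (simp only: mult_ac)
  also have "d powr - (?m / 2) * ((K - 1 - ?s) / (K - 1)) powr - (?m / 2) = ((K - 1 - ?s) / K) powr - (?m / 2)"
  proof -
    have "d * ((K - 1 - ?s) / (K - 1)) = (K - 1 - ?s) / K"
      using K by (simp add: d_def divide_simps)
    then show ?thesis using d K by (simp add: powr_mult[symmetric])
  qed
  also have "G a * (\<Prod>k<card S. G (a - 1/2 - real k / 2)) = (\<Prod>k<card (insert k S). G (a - real k / 2))"
    using insert.hyps by (simp add: prod.lessThan_Suc_shift algebra_simps add_divide_distrib del: prod.lessThan_Suc)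
  finally show ?case
    using insert.hyps by (simp add: G_def algebra_simps add_divide_distrib)
qed

lemma prod_Basis_vec:
  "(\<Prod>b\<in>(Basis :: ('a::euclidean_space^'n) set). f b) = (\<Prod>i\<in>UNIV. \<Prod>b\<in>Basis. f (axis i b))"
proof -
  have "(Basis :: ('a^'n) set) = (\<lambda>(i, b). axis i b) ` (UNIV \<times> Basis)"
    by (auto simp: Basis_vec_def)
  moreover have "inj_on (\<lambda>(i, b). axis i b) (UNIV \<times> (Basis :: 'a set))"
    by (auto simp: inj_on_def axis_eq_axis)
  ultimately have "prod f Basis = (\<Prod>p\<in>UNIV \<times> (Basis :: 'a set). f (case p of (i, b) \<Rightarrow> axis i b))"
    using prod.reindex[of "\<lambda>(i, b). axis i b" "UNIV \<times> (Basis :: 'a set)" f] by (simp add: o_def)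
  then show ?thesis
    by (simp add: prod.cartesian_product case_prod_unfold)
qed

lemma measurable_vec_lambda:
  "(\<lambda>y. \<chi> i. y i) \<in> PiM UNIV (\<lambda>_. lborel) \<rightarrow>\<^sub>M (borel :: ('a::euclidean_space^'n) measure)"
proof (subst borel_measurable_euclidean_space, rule ballI)
  fix b :: "'a^'n" assume "b \<in> Basis"
  then obtain i c where b: "b = axis i c" by (auto simp: Basis_vec_def)
  have "(\<lambda>y. y i) \<in> PiM UNIV (\<lambda>_. lborel) \<rightarrow>\<^sub>M (lborel :: 'a measure)"
    by (rule measurable_component_singleton) simp
  then show "(\<lambda>y. (\<chi> i. y i) \<bullet> b) \<in> borel_measurable (PiM UNIV (\<lambda>_. lborel))"
    by (simp add: b inner_axis)
qed

text \<open>
  Lebesgue measure on a sample is the product of the Lebesgue measures of the observations, since the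
  two agree on boxes.
\<close>

lemma lborel_vec_eq_PiM:
  "(lborel :: ('a::euclidean_space^'n) measure) = distr (PiM UNIV (\<lambda>_. lborel)) borel (\<lambda>y. \<chi> i. y i)"
proof (rule lborel_eqI)
  interpret finite_product_sigma_finite "\<lambda>_::'n. lborel :: 'a measure" UNIV by unfold_locales simp
  note measurable_vec_lambda[measurable]
  fix l u :: "'a^'n" assume le: "\<And>b. b \<in> Basis \<Longrightarrow> l \<bullet> b \<le> u \<bullet> b"
  have le': "l $ i \<bullet> b \<le> u $ i \<bullet> b" if "b \<in> Basis" for i b
    using le[of "axis i b"] that by (simp add: inner_axis)
  have "(\<lambda>y. \<chi> i. y i) -` box l u \<inter> space (PiM UNIV (\<lambda>_. lborel)) = Pi\<^sub>E UNIV (\<lambda>i. box (l $ i) (u $ i))"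
    by (auto simp: space_PiM box_def Basis_vec_def inner_axis)
  then have "emeasure (distr (PiM UNIV (\<lambda>_. lborel)) borel (\<lambda>y. \<chi> i. y i)) (box l u)
    = emeasure (PiM UNIV (\<lambda>_. lborel)) (Pi\<^sub>E UNIV (\<lambda>i. box (l $ i) (u $ i)))"
    by (simp add: emeasure_distr)
  also have "\<dots> = (\<Prod>i\<in>UNIV. emeasure lborel (box (l $ i) (u $ i)))"
    by (rule measure_times) simp
  also have "\<dots> = (\<Prod>i\<in>UNIV. ennreal (\<Prod>b\<in>Basis. (u $ i - l $ i) \<bullet> b))"
    using le' by (simp add: emeasure_lborel_box)
  also have "\<dots> = ennreal (\<Prod>i\<in>UNIV. \<Prod>b\<in>Basis. (u $ i - l $ i) \<bullet> b)"
    using le' by (intro prod_ennreal prod_nonneg) (simp add: inner_diff_left)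
  also have "(\<Prod>i\<in>UNIV. \<Prod>b\<in>Basis. (u $ i - l $ i) \<bullet> b) = (\<Prod>b\<in>Basis. (u - l) \<bullet> b)"
    by (simp add: prod_Basis_vec inner_axis)
  finally show "emeasure (distr (PiM UNIV (\<lambda>_. lborel)) borel (\<lambda>y. \<chi> i. y i)) (box l u)
    = ennreal (\<Prod>b\<in>Basis. (u - l) \<bullet> b)" .
qed simp

lemma nn_integral_det_scatter_vec:
  fixes B :: "real^'m^'m" and c :: "real^'m" and K a :: real
  assumes "pos_def_matrix B" "K > real CARD('n)" "a > (real CARD('n) - 1 + CARD('m)) / 2"
  shows "(\<lambda>x :: real^'m^'n. det (scatter B UNIV K (\<lambda>i. x $ i - c))) \<in> borel_measurable borel" (is ?meas)
    "(\<integral>\<^sup>+x. ennreal (det (scatter B UNIV K (\<lambda>i. x $ i - c)) powr - a) \<partial>(lborel :: (real^'m^'n) measure))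
    = ennreal (det B powr - (a - CARD('n) / 2) * ((K - CARD('n)) / K) powr - (CARD('m) / 2) *
        (\<Prod>k<CARD('n). pi powr (CARD('m) / 2) * Gamma (a - real k / 2 - CARD('m) / 2) / Gamma (a - real k / 2)))" (is ?int)
proof -
  have K: "K \<noteq> 0" using assms(2) of_nat_0_le_iff[of "CARD('n)", where 'a = real] by linarith
  have meas: "(\<lambda>x :: real^'m^'n. det (scatter B UNIV K (\<lambda>i. x $ i - c))) \<in> borel_measurable borel" for c
  proof (intro borel_measurable_det)
    fix p q :: 'm
    show "(\<lambda>x :: real^'m^'n. scatter B UNIV K (\<lambda>i. x $ i - c) $ p $ q) \<in> borel_measurable borel"
      unfolding scatter_component by (intro borel_measurable_continuous_onI) (auto intro!: continuous_intros simp: K)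
  qed
  then show ?meas .
  let ?g = "\<lambda>x :: real^'m^'n. ennreal (det (scatter B UNIV K (\<lambda>i. x $ i)) powr - a)"
  have g[measurable]: "?g \<in> borel_measurable borel"
    by (rule measurable_compose[OF meas[of 0, simplified]]) measurable
  have vec: "(\<lambda>y. \<chi> i. y i) \<in> PiM UNIV (\<lambda>_. lborel) \<rightarrow>\<^sub>M (borel :: (real^'m^'n) measure)"
    by (rule measurable_vec_lambda)
  have "(\<integral>\<^sup>+x. ennreal (det (scatter B UNIV K (\<lambda>i. x $ i - c)) powr - a) \<partial>(lborel :: (real^'m^'n) measure))
     = (\<integral>\<^sup>+x. ?g ((\<chi> i. - c) + x) \<partial>lborel)"
    by simp
  also have "\<dots> = (\<integral>\<^sup>+x. ?g x \<partial>lborel)"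
    by (rule nn_integral_lborel_translate[OF g])
  also have "\<dots> = (\<integral>\<^sup>+y. ennreal (det (scatter B UNIV K y) powr - a) \<partial>PiM UNIV (\<lambda>_::'n. lborel))"
  proof -
    have "($) (vec_lambda y) = y" for y :: "'n \<Rightarrow> real^'m" by (rule ext) simp
    then show ?thesis
      by (subst lborel_vec_eq_PiM, subst nn_integral_distr[OF vec]) (use g in simp_all)
  qed
  also have "\<dots> = ennreal (det B powr - (a - CARD('n) / 2) * ((K - CARD('n)) / K) powr - (CARD('m) / 2) *
        (\<Prod>k<CARD('n). pi powr (CARD('m) / 2) * Gamma (a - real k / 2 - CARD('m) / 2) / Gamma (a - real k / 2)))"
    using assms by (intro nn_integral_det_scatter) auto
  finally show ?int .
qed

section \<open>The MAP estimates\<close>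

lemma det_scaleR_matrix: "det (r *\<^sub>R A) = r ^ CARD('m) * det A" for A :: "real^'m^'m"
proof -
  have "r *\<^sub>R A = (r *\<^sub>R mat 1) ** A" by (simp add: matrix_mult_scaleR_left)
  then have "det (r *\<^sub>R A) = det (r *\<^sub>R mat 1 :: real^'m^'m) * det A" by (simp add: det_mul)
  also have "det (r *\<^sub>R mat 1 :: real^'m^'m) = r ^ CARD('m)"
    by (subst det_diagonal) (simp_all add: mat_def)
  finally show ?thesis .
qed

lemma pos_def_scaleR: "c > 0 \<Longrightarrow> pos_def_matrix A \<Longrightarrow> pos_def_matrix (c *\<^sub>R A)"
  by (simp add: pos_def_matrix_def transpose_scalar scaleR_matrix_vector_assoc[symmetric])

lemma pos_def_inverse:
  fixes A :: "real^'m^'m"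
  assumes A: "pos_def_matrix A"
  shows "A ** matrix_inv A = mat 1" "matrix_inv A ** A = mat 1" "pos_def_matrix (matrix_inv A)"
proof -
  have "det A > 0" using A by (rule pos_def_det_pos)
  then have "invertible A" by (simp add: invertible_det_nz)
  then have "\<exists>A'. A ** A' = mat 1 \<and> A' ** A = mat 1" by (simp add: invertible_def)
  then have inv: "A ** matrix_inv A = mat 1 \<and> matrix_inv A ** A = mat 1"
    unfolding matrix_inv_def by (rule someI_ex)
  then show "A ** matrix_inv A = mat 1" "matrix_inv A ** A = mat 1" by auto
  show "pos_def_matrix (matrix_inv A)"
    unfolding pos_def_matrix_def
  proof (intro conjI allI impI)
    have "transpose (matrix_inv A) ** A = mat 1"
      using inv A by (metis matrix_transpose_mul pos_def_matrix_def transpose_mat)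
    then show "transpose (matrix_inv A) = matrix_inv A"
      using inv by (metis matrix_mul_assoc matrix_mul_lid matrix_mul_rid)
    fix v :: "real^'m" assume v: "v \<noteq> 0"
    let ?w = "matrix_inv A *v v"
    have Aw: "A *v ?w = v" using inv by (simp add: matrix_vector_mul_assoc)
    then have "?w \<noteq> 0" using v by (metis matrix_vector_mult_0_right)
    then have "0 < ?w \<bullet> (A *v ?w)" using A by (simp add: pos_def_matrix_def)
    then show "0 < v \<bullet> ?w" by (simp only: Aw inner_commute)
  qed
qed

text \<open>
  With \<open>S = L L\<^sup>T\<close>, this is \<open>ln_det_le_trace\<close> for the positive definite matrix \<open>L\<^sup>T A\<inverse> L\<close>.
\<close>

lemma ln_det_ratio_le_trace:
  fixes A S :: "real^'m^'m"
  assumes A: "pos_def_matrix A" and S: "pos_def_matrix S"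
  shows "ln (det S) - ln (det A) \<le> trace (matrix_inv A ** S) - CARD('m)"
proof -
  let ?P = "matrix_inv A"
  obtain L where L: "L ** transpose L = S" "det L \<noteq> 0"
    using pos_def_factorization[OF S] by metis
  have dS: "det S > 0" using S by (rule pos_def_det_pos)
  have dA: "det A > 0" using A by (rule pos_def_det_pos)
  have P: "transpose ?P = ?P" "\<And>v. v \<noteq> 0 \<Longrightarrow> 0 < v \<bullet> (?P *v v)"
    using pos_def_inverse(3)[OF A] by (auto simp: pos_def_matrix_def)
  let ?M = "transpose L ** ?P ** L"
  have "pos_def_matrix ?M"
    unfolding pos_def_matrix_def
  proof (intro conjI allI impI)
    show "transpose ?M = ?M" by (simp add: matrix_transpose_mul P matrix_mul_assoc)
    fix v :: "real^'m" assume "v \<noteq> 0"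
    have "inj ((*v) L)" using L(2) det_nz_iff_inj[of "(*v) L"] by simp
    then have "L *v v \<noteq> 0" using \<open>v \<noteq> 0\<close> by (metis injD matrix_vector_mult_0_right)
    from P(2)[OF this] have "0 < (L *v v) \<bullet> (?P *v (L *v v))" .
    also have "\<dots> = v \<bullet> (transpose L *v (?P *v (L *v v)))"
      by (simp add: dot_lmul_matrix inner_commute[of v])
        (simp add: inner_commute)
    finally show "0 < v \<bullet> (?M *v v)" by (simp only: matrix_vector_mul_assoc matrix_mul_assoc)
  qed
  from ln_det_le_trace[OF this] have "ln (det ?M) \<le> trace ?M - CARD('m)" .
  moreover have "det ?M = det S / det A"
  proof -
    have "det A * det ?P = 1" by (metis det_I det_mul pos_def_inverse(1)[OF A])
    then have "det ?P = 1 / det A" using dA by (simp add: field_simps)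
    moreover have "det S = det L * det L" unfolding L(1)[symmetric] by (simp add: det_mul)
    ultimately show ?thesis by (simp add: det_mul)
  qed
  moreover have "trace ?M = trace (?P ** S)"
  proof -
    have "trace ?M = trace (transpose L ** (?P ** L))" by (simp add: matrix_mul_assoc)
    also have "\<dots> = trace ((?P ** L) ** transpose L)" by (rule trace_mul_sym)
    also have "\<dots> = trace (?P ** S)" by (simp add: matrix_mul_assoc[symmetric] L)
    finally show ?thesis .
  qed
  ultimately show ?thesis using dS dA by (simp add: ln_div)
qed

lemma trace_mult_outer: "trace (P ** outer u v) = v \<bullet> (P *v u)"
  by (simp add: trace_def matrix_matrix_mult_def outer_def inner_vec_def matrix_vector_mult_def
      sum_distrib_left mult_ac)

lemma trace_scaleR: "trace (c *\<^sub>R A) = c * trace A" for A :: "real^'m^'m"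
  by (simp add: trace_def sum_distrib_left)

lemma trace_mult_sum: "trace (P ** (\<Sum>i\<in>I. A i)) = (\<Sum>i\<in>I. trace (P ** A i))"
  for P :: "real^'m^'m"
  by (induction I rule: infinite_finite_induct) (simp_all add: matrix_add_ldistrib trace_add trace_0[simplified])

context
  fixes \<nu> \<rho>2 :: real and \<mu>0 :: "real^'m" and \<Sigma>0 :: "real^'m^'m"
  assumes \<nu>: "\<nu> > 0" and \<rho>2: "\<rho>2 > 0" and \<Sigma>0: "pos_def_matrix \<Sigma>0"
begin

lemma map_cov_eq_scatter:
  fixes x :: "real^'m^'n"
  shows "map_cov \<nu> \<rho>2 \<mu>0 \<Sigma>0 x = (1 / (CARD('n) + \<nu>)) *\<^sub>R
    scatter (\<nu> *\<^sub>R \<Sigma>0) UNIV (CARD('n) + \<rho>2 * \<nu>) (\<lambda>i. x $ i - \<mu>0)"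
proof -
  have pos: "real CARD('n) + \<nu> > 0" "real CARD('n) + \<rho>2 * \<nu> > 0"
    using \<nu> \<rho>2 by (auto intro: add_nonneg_pos)
  have *: "(\<Sum>i\<in>UNIV. \<Sum>j\<in>UNIV. (x $ i $ p - \<mu>0 $ p) * (x $ j $ q - \<mu>0 $ q))
    = (\<Sum>i\<in>UNIV. x $ i $ p - \<mu>0 $ p) * (\<Sum>i\<in>UNIV. x $ i $ q - \<mu>0 $ q)" for p q
    by (simp add: sum_product)
  have **: "1 / N * (s + b) - 1 / ((\<nu> + real CARD('n)) * (\<rho>2 * \<nu> + real CARD('n))) * t
      = 1 / N * (b + s - t / K)" if "N = real CARD('n) + \<nu>" "K = real CARD('n) + \<rho>2 * \<nu>" for s b t N K
  proof -
    have "N \<noteq> 0" "K \<noteq> 0" using pos by (auto simp: that)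
    then have "1 / N * (s + b) - 1 / (N * K) * t = 1 / N * (b + s - t / K)"
      by (simp add: field_simps)
    then show ?thesis by (simp add: that add.commute)
  qed
  show ?thesis
    unfolding vec_eq_iff
    by (intro allI) (simp only: map_cov_def scatter_component vector_scaleR_component
        vector_minus_component vector_add_component sum_component outer_def vec_lambda_beta
        real_scaleR_def * **[OF refl refl])
qed

lemma pos_def_map_cov: "pos_def_matrix (map_cov \<nu> \<rho>2 \<mu>0 \<Sigma>0 (x :: real^'m^'n))"
  unfolding map_cov_eq_scatter using \<nu> \<rho>2
  by (intro pos_def_scaleR pos_def_scatter \<Sigma>0) (auto intro: add_nonneg_pos)

text \<open>
  Collecting the terms of the exponent that \<open>\<Sigma>\<inverse>\<close> multiplies, and completing the square in \<open>\<mu>\<close>.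
\<close>

lemma complete_square:
  fixes x :: "real^'m^'n"
  shows "(\<Sum>i\<in>UNIV. outer (x $ i - \<mu>) (x $ i - \<mu>)) + \<nu> *\<^sub>R (\<Sigma>0 + \<rho>2 *\<^sub>R outer (\<mu> - \<mu>0) (\<mu> - \<mu>0))
    = (CARD('n) + \<nu>) *\<^sub>R map_cov \<nu> \<rho>2 \<mu>0 \<Sigma>0 x
      + (CARD('n) + \<rho>2 * \<nu>) *\<^sub>R outer (\<mu> - map_mean \<nu> \<rho>2 \<mu>0 x) (\<mu> - map_mean \<nu> \<rho>2 \<mu>0 x)"
proof -
  define y where "y i = x $ i - \<mu>0" for i
  define \<delta> where "\<delta> = \<mu> - \<mu>0"
  define K where "K = real CARD('n) + \<rho>2 * \<nu>"
  have pos: "real CARD('n) + \<nu> > 0" "K > 0"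
    using \<nu> \<rho>2 by (auto simp: K_def intro: add_nonneg_pos)
  have x: "x $ i - \<mu> = y i - \<delta>" for i by (simp add: y_def \<delta>_def)
  have mean: "\<mu> - map_mean \<nu> \<rho>2 \<mu>0 x = \<delta> - (1 / K) *\<^sub>R (\<Sum>i\<in>UNIV. y i)"
    by (simp add: map_mean_def y_def \<delta>_def K_def)
  have cov: "(CARD('n) + \<nu>) *\<^sub>R map_cov \<nu> \<rho>2 \<mu>0 \<Sigma>0 x = scatter (\<nu> *\<^sub>R \<Sigma>0) UNIV K y"
    using pos by (simp add: map_cov_eq_scatter y_def[abs_def] K_def)
  have *: "(\<Sum>i\<in>UNIV. (y i $ p - \<delta> $ p) * (y i $ q - \<delta> $ q))
     = (\<Sum>i\<in>UNIV. y i $ p * y i $ q) - \<delta> $ q * (\<Sum>i\<in>UNIV. y i $ p) - \<delta> $ p * (\<Sum>i\<in>UNIV. y i $ q)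
       + CARD('n) * (\<delta> $ p * \<delta> $ q)" for p q
    by (simp add: algebra_simps sum.distrib sum_subtractf sum_distrib_left)
  have **: "yy - dq * sp - dp * sq + n * (dp * dq) + \<nu> * (b + \<rho>2 * (dp * dq))
     = \<nu> * b + yy - sp * sq / K + K * ((dp - 1 / K * sp) * (dq - 1 / K * sq))"
    if "n = real CARD('n)" for yy dq sp dp sq n b :: real
  proof -
    have "K * ((dp - 1 / K * sp) * (dq - 1 / K * sq)) = K * (dp * dq) - dp * sq - dq * sp + sp * sq / K"
      using pos(2) by (simp add: field_simps)
    then show ?thesis by (simp add: that K_def algebra_simps)
  qed
  show ?thesis
    unfolding x mean cov \<delta>_def[symmetric] K_def[symmetric] vec_eq_iff
    by (intro allI) (simp only: scatter_component vector_scaleR_component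
        vector_minus_component vector_add_component sum_component outer_def vec_lambda_beta
        real_scaleR_def * **[OF refl])
qed

text \<open>
  The parameters separate: \<open>\<mu>\<close> enters only through a nonnegative form that vanishes at the MAP mean,
  whichever positive definite \<open>\<Sigma>\<close> is chosen.
\<close>

lemma penalised_likelihood:
  fixes x :: "real^'m^'n"
  shows "normal_lik x (\<mu>, \<Sigma>) * normal_luckiness \<nu> \<rho>2 \<mu>0 \<Sigma>0 (\<mu>, \<Sigma>)
    = 1 / ((2 * pi) powr (CARD('m) * (CARD('n) + \<nu>) / 2) * det \<Sigma> powr ((CARD('n) + \<nu>) / 2)) *
      exp (- (1 / 2) * ((CARD('n) + \<nu>) * trace (matrix_inv \<Sigma> ** map_cov \<nu> \<rho>2 \<mu>0 \<Sigma>0 x)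
        + (CARD('n) + \<rho>2 * \<nu>) * ((\<mu> - map_mean \<nu> \<rho>2 \<mu>0 x) \<bullet> (matrix_inv \<Sigma> *v (\<mu> - map_mean \<nu> \<rho>2 \<mu>0 x)))))"
proof -
  let ?P = "matrix_inv \<Sigma>"
  let ?m = "real CARD('m)" and ?n = "real CARD('n)"
  let ?q = "\<Sum>i\<in>UNIV. (x $ i - \<mu>) \<bullet> (?P *v (x $ i - \<mu>))"
  let ?t = "trace (?P ** (\<Sigma>0 + \<rho>2 *\<^sub>R outer (\<mu> - \<mu>0) (\<mu> - \<mu>0)))"
  let ?e = "(?n + \<nu>) * trace (?P ** map_cov \<nu> \<rho>2 \<mu>0 \<Sigma>0 x)
        + (?n + \<rho>2 * \<nu>) * ((\<mu> - map_mean \<nu> \<rho>2 \<mu>0 x) \<bullet> (?P *v (\<mu> - map_mean \<nu> \<rho>2 \<mu>0 x)))"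
  have "?q + \<nu> * ?t = trace (?P ** ((\<Sum>i\<in>UNIV. outer (x $ i - \<mu>) (x $ i - \<mu>)) + \<nu> *\<^sub>R (\<Sigma>0 + \<rho>2 *\<^sub>R outer (\<mu> - \<mu>0) (\<mu> - \<mu>0))))"
    by (simp add: matrix_add_ldistrib trace_add trace_mult_sum trace_mult_outer matrix_mult_scaleR_right trace_scaleR
        del: scaleR_add_right)
  also have "\<dots> = ?e"
    unfolding complete_square
    by (simp add: matrix_add_ldistrib trace_add trace_mult_outer matrix_mult_scaleR_right trace_scaleR)
  finally have "?q + \<nu> * ?t = ?e" .
  moreover have "exp (- (1 / 2) * q) * exp (- (\<nu> / 2) * t) = exp (- (1 / 2) * e)"
    if "q + \<nu> * t = e" for q t e
    by (simp add: mult_exp_exp that[symmetric] algebra_simps)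
  ultimately have e: "exp (- (1 / 2) * ?q) * exp (- (\<nu> / 2) * ?t) = exp (- (1 / 2) * ?e)"
    by blast
  have p: "(2 * pi) powr (?m * (?n + \<nu>) / 2) = (2 * pi) powr (?m * ?n / 2) * (2 * pi) powr (?m * \<nu> / 2)"
    "det \<Sigma> powr ((?n + \<nu>) / 2) = det \<Sigma> powr (?n / 2) * det \<Sigma> powr (\<nu> / 2)"
    by (simp_all add: powr_add[symmetric] algebra_simps add_divide_distrib)
  show ?thesis
    unfolding p e[symmetric] by (simp add: normal_lik_def normal_luckiness_def)
qed

text \<open>
  At the MAP covariance the trace is that of the identity, so the exponential is independent of the
  data. Hence the maximum is a constant times a power of the determinant of the MAP covariance.
\<close>

lemma penalised_likelihood_at_map:
  fixes x :: "real^'m^'n"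
  shows "normal_lik x (map_mean \<nu> \<rho>2 \<mu>0 x, map_cov \<nu> \<rho>2 \<mu>0 \<Sigma>0 x) *
      normal_luckiness \<nu> \<rho>2 \<mu>0 \<Sigma>0 (map_mean \<nu> \<rho>2 \<mu>0 x, map_cov \<nu> \<rho>2 \<mu>0 \<Sigma>0 x)
    = 1 / ((2 * pi) powr (CARD('m) * (CARD('n) + \<nu>) / 2) * det (map_cov \<nu> \<rho>2 \<mu>0 \<Sigma>0 x) powr ((CARD('n) + \<nu>) / 2)) *
      exp (- (CARD('m) * (CARD('n) + \<nu>) / 2))"
  using pos_def_inverse(2)[OF pos_def_map_cov[of x]]
  by (simp add: penalised_likelihood trace_I mult.commute)

lemma penalised_likelihood_le_map:
  fixes x :: "real^'m^'n"
  assumes \<Sigma>: "pos_def_matrix \<Sigma>"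
  shows "normal_lik x (\<mu>, \<Sigma>) * normal_luckiness \<nu> \<rho>2 \<mu>0 \<Sigma>0 (\<mu>, \<Sigma>)
    \<le> normal_lik x (map_mean \<nu> \<rho>2 \<mu>0 x, map_cov \<nu> \<rho>2 \<mu>0 \<Sigma>0 x) *
      normal_luckiness \<nu> \<rho>2 \<mu>0 \<Sigma>0 (map_mean \<nu> \<rho>2 \<mu>0 x, map_cov \<nu> \<rho>2 \<mu>0 \<Sigma>0 x)"
proof -
  define S where "S = map_cov \<nu> \<rho>2 \<mu>0 \<Sigma>0 x"
  define N where "N = real CARD('n) + \<nu>"
  define u where "u = \<mu> - map_mean \<nu> \<rho>2 \<mu>0 x"
  define t where "t = trace (matrix_inv \<Sigma> ** S)"
  define Q where "Q = (CARD('n) + \<rho>2 * \<nu>) * (u \<bullet> (matrix_inv \<Sigma> *v u))"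
  have S: "pos_def_matrix S" unfolding S_def by (rule pos_def_map_cov)
  have dS: "det S > 0" and d\<Sigma>: "det \<Sigma> > 0"
    using pos_def_det_pos S \<Sigma> by blast+
  have N: "N > 0" using \<nu> by (simp add: N_def add_nonneg_pos)
  have "u \<bullet> (matrix_inv \<Sigma> *v u) \<ge> 0"
    using pos_def_inverse(3)[OF \<Sigma>] by (cases "u = 0") (auto simp: pos_def_matrix_def intro: less_imp_le)
  then have Q: "Q \<ge> 0" using \<nu> \<rho>2 by (simp add: Q_def)
  have "(N / 2) * (ln (det S) - ln (det \<Sigma>)) \<le> (N / 2) * (t - CARD('m))"
    using N ln_det_ratio_le_trace[OF \<Sigma> S] by (intro mult_left_mono) (auto simp: t_def)
  then have "- ((N / 2) * ln (det \<Sigma>)) - 1 / 2 * (N * t + Q) \<le> - ((N / 2) * ln (det S)) - CARD('m) * N / 2"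
    using Q by (simp add: algebra_simps add_divide_distrib)
  then have "exp (- ((N / 2) * ln (det \<Sigma>)) - 1 / 2 * (N * t + Q)) \<le> exp (- ((N / 2) * ln (det S)) - CARD('m) * N / 2)"
    by simp
  moreover have "1 / d powr p * exp e = exp (- (p * ln d) + e)" if "d > 0" for d p e :: real
    using that by (simp add: powr_def exp_diff divide_inverse mult.commute)
  ultimately have "1 / det \<Sigma> powr (N / 2) * exp (- (1 / 2) * (N * t + Q)) \<le> 1 / det S powr (N / 2) * exp (- (CARD('m) * N / 2))"
    using dS d\<Sigma> by simp
  then have "1 / (2 * pi) powr (CARD('m) * N / 2) * (1 / det \<Sigma> powr (N / 2) * exp (- (1 / 2) * (N * t + Q)))
    \<le> 1 / (2 * pi) powr (CARD('m) * N / 2) * (1 / det S powr (N / 2) * exp (- (CARD('m) * N / 2)))"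
    by (intro mult_left_mono) auto
  then show ?thesis
    unfolding penalised_likelihood_at_map unfolding penalised_likelihood
    by (simp add: S_def N_def t_def Q_def u_def)
qed

lemma is_arg_max_map:
  fixes x :: "real^'m^'n"
  shows "is_arg_max (\<lambda>\<theta>. normal_lik x \<theta> * normal_luckiness \<nu> \<rho>2 \<mu>0 \<Sigma>0 \<theta>) (\<lambda>\<theta>. \<theta> \<in> normal_params)
    (map_mean \<nu> \<rho>2 \<mu>0 x, map_cov \<nu> \<rho>2 \<mu>0 \<Sigma>0 x)"
  using pos_def_map_cov[of x] penalised_likelihood_le_map[of _ x]
  by (auto simp: is_arg_max_linorder normal_params_def)

lemma lnml_max_eq_map:
  fixes x :: "real^'m^'n"
  shows "lnml_max normal_lik (normal_luckiness \<nu> \<rho>2 \<mu>0 \<Sigma>0) normal_params x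
    = normal_lik x (map_mean \<nu> \<rho>2 \<mu>0 x, map_cov \<nu> \<rho>2 \<mu>0 \<Sigma>0 x) *
      normal_luckiness \<nu> \<rho>2 \<mu>0 \<Sigma>0 (map_mean \<nu> \<rho>2 \<mu>0 x, map_cov \<nu> \<rho>2 \<mu>0 \<Sigma>0 x)"
  unfolding lnml_max_def
  by (rule Greatest_equality)
    (use pos_def_map_cov[of x] penalised_likelihood_le_map[of _ x] in \<open>auto simp: normal_params_def\<close>)

end

section \<open>Gamma products and constants\<close>

text \<open>
  Both ways of splitting one end factor off the product of \<open>Gamma (x + 1/2 - j / 2)\<close> over \<open>j \<le> m\<close>.
\<close>

lemma prod_Gamma_half_shift:
  fixes x :: real
  assumes x: "x > (real m - 1) / 2"
  shows "(\<Prod>j<m. Gamma (x - real j / 2)) / (\<Prod>j<m. Gamma (x + 1/2 - real j / 2))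
    = Gamma (x + 1/2 - m / 2) / Gamma (x + 1/2)"
proof -
  let ?G = "\<lambda>x. \<Prod>j<m. Gamma (x - real j / 2)"
  have pos: "Gamma (y - real j / 2) > 0" if "j < m" "y \<ge> x" for j y
    using that x by (intro Gamma_real_pos) (auto simp: field_simps)
  have "?G (x + 1/2) * Gamma (x + 1/2 - m / 2) = (\<Prod>j<Suc m. Gamma (x + 1/2 - real j / 2))"
    by simp
  also have "\<dots> = Gamma (x + 1/2) * ?G x"
    by (subst prod.lessThan_Suc_shift) (simp add: add_divide_distrib algebra_simps)
  finally have "?G (x + 1/2) * Gamma (x + 1/2 - m / 2) = Gamma (x + 1/2) * ?G x" .
  moreover have "?G (x + 1/2) > 0" by (intro prod_pos) (auto intro: pos)
  moreover have "Gamma (x + 1/2) > 0"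
    using x by (intro Gamma_real_pos) (auto simp: field_simps)
  moreover have "p / q = a / b" if "q * a = b * p" "q > 0" "b > 0" for a b p q :: real
    using that by (simp add: frac_eq_eq mult_ac)
  ultimately show ?thesis by blast
qed

text \<open>
  Integrating the observations out produces one ratio of Gamma values per observation, whereas the
  multivariate gamma function has one factor per dimension. All arguments are spaced by 1/2, and both
  sides are the ratio of the same two blocks of consecutive arguments after cancellation.
\<close>

lemma prod_Gamma_telescope:
  fixes \<nu> :: real
  assumes \<nu>: "\<nu> > real m - 1"
  shows "(\<Prod>k<n. Gamma ((real n + \<nu>) / 2 - real k / 2 - m / 2) / Gamma ((real n + \<nu>) / 2 - real k / 2))
    = (\<Prod>j<m. Gamma (\<nu> / 2 - real j / 2)) / (\<Prod>j<m. Gamma ((real n + \<nu>) / 2 - real j / 2))"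
proof (induction n)
  case 0
  have "(\<Prod>j<m. Gamma (\<nu> / 2 - real j / 2)) > 0"
    using \<nu> by (intro prod_pos Gamma_real_pos ballI) (auto simp: field_simps)
  then have "(\<Prod>j<m. Gamma (\<nu> / 2 - real j / 2)) / (\<Prod>j<m. Gamma (\<nu> / 2 - real j / 2)) = 1"
    by (intro divide_self less_imp_neq[symmetric])
  then show ?case by (simp only: lessThan_0 prod.empty of_nat_0 add_0)
next
  case (Suc n)
  define x where "x = (real n + \<nu>) / 2"
  have x: "(real (Suc n) + \<nu>) / 2 = x + 1/2" by (simp add: x_def field_simps)
  have xm: "x > (real m - 1) / 2" using \<nu> by (simp add: x_def)
  have "(\<Prod>j<m. Gamma (x - real j / 2)) > 0"
    using xm by (intro prod_pos Gamma_real_pos ballI) (auto simp: field_simps)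
  then have nz: "(\<Prod>j<m. Gamma (x - real j / 2)) \<noteq> 0" by (rule less_imp_neq[symmetric])
  have "(\<Prod>k<Suc n. Gamma (x + 1/2 - real k / 2 - m / 2) / Gamma (x + 1/2 - real k / 2))
    = Gamma (x + 1/2 - m / 2) / Gamma (x + 1/2) * (\<Prod>k<n. Gamma (x - real k / 2 - m / 2) / Gamma (x - real k / 2))"
    by (subst prod.lessThan_Suc_shift) (simp add: add_divide_distrib algebra_simps)
  also have "\<dots> = (\<Prod>j<m. Gamma (\<nu> / 2 - real j / 2)) / (\<Prod>j<m. Gamma (x + 1/2 - real j / 2))"
    unfolding prod_Gamma_half_shift[OF xm, symmetric] Suc.IH[folded x_def]
    by (simp only: times_divide_times_eq mult.commute mult_divide_mult_cancel_left[OF nz])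
  finally show ?case unfolding x .
qed

lemma multi_Gamma_pos:
  assumes "z > (real m - 1) / 2"
  shows "multi_Gamma m z > 0"
proof -
  have "Gamma (z - real j / 2) > 0" if "j < m" for j
    using that assms by (intro Gamma_real_pos) (auto simp: field_simps)
  then show ?thesis unfolding multi_Gamma_def by (intro mult_pos_pos prod_pos) auto
qed

lemma prod_Gamma_eq_multi_Gamma:
  assumes \<nu>: "\<nu> > real m - 1"
  shows "(\<Prod>k<n. pi powr (m / 2) * Gamma ((real n + \<nu>) / 2 - real k / 2 - m / 2) / Gamma ((real n + \<nu>) / 2 - real k / 2))
    = pi powr (m * n / 2) * (multi_Gamma m (\<nu> / 2) / multi_Gamma m ((real n + \<nu>) / 2))"
proof -
  have "(\<Prod>k<n. pi powr (m / 2) * Gamma ((real n + \<nu>) / 2 - real k / 2 - m / 2) / Gamma ((real n + \<nu>) / 2 - real k / 2))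
    = (pi powr (m / 2)) ^ n * (\<Prod>k<n. Gamma ((real n + \<nu>) / 2 - real k / 2 - m / 2) / Gamma ((real n + \<nu>) / 2 - real k / 2))"
    by (simp add: prod.distrib prod_dividef)
  also have "(pi powr (m / 2)) ^ n = pi powr (m * n / 2)"
    by (simp add: powr_realpow[symmetric] powr_powr)
  finally show ?thesis
    unfolding prod_Gamma_telescope[OF \<nu>] by (simp add: multi_Gamma_def)
qed

text \<open>
  The left-hand side collects the constants as they arise: normalization of the density, the value
  of the exponential, the factor between the MAP covariance and the scatter matrix, and the
  integral. All factors are positive, so the logarithms can be compared, and these are linear in the
  logarithms of the parameters.
\<close>

lemma capacity_constant:
  fixes m n :: nat and \<nu> \<rho>2 D :: real
  assumes m: "m > 0" and \<nu>: "\<nu> > 0" "\<nu> > real m - 1" and \<rho>2: "\<rho>2 > 0" and D: "D > 0"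
  shows "1 / (2 * pi) powr (m * (n + \<nu>) / 2) * exp (- (m * (n + \<nu>) / 2)) * (n + \<nu>) powr (m * (n + \<nu>) / 2) *
     ((\<nu> ^ m * D) powr - (\<nu> / 2) * (\<rho>2 * \<nu> / (n + \<rho>2 * \<nu>)) powr - (m / 2) *
      (pi powr (m * n / 2) * (multi_Gamma m (\<nu> / 2) / multi_Gamma m ((n + \<nu>) / 2))))
    = capacity_formula m n \<nu> (D powr (1 / m)) \<rho>2" (is "?l = ?r")
proof -
  define R where "R = multi_Gamma m (\<nu> / 2) / multi_Gamma m ((n + \<nu>) / 2)"
  have R: "R > 0" unfolding R_def using \<nu> by (intro divide_pos_pos multi_Gamma_pos) auto
  define N where "N = n + \<nu>"
  have N: "N > 0" using \<nu> by (simp add: N_def)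
  define q where "q = 1 + n / (\<rho>2 * \<nu>)"
  have q: "q > 0" using \<nu> \<rho>2 by (simp add: q_def add_pos_nonneg)
  have q': "\<rho>2 * \<nu> / (n + \<rho>2 * \<nu>) = 1 / q"
    using \<nu> \<rho>2 q by (simp add: q_def field_simps)
  have n: "real n = N - \<nu>" by (simp add: N_def)
  have l: "?l = 1 / (2 * pi) powr (m * N / 2) * exp (- (m * N / 2)) * N powr (m * N / 2) *
     ((\<nu> ^ m * D) powr - (\<nu> / 2) * (1 / q) powr - (m / 2) * (pi powr (m * (N - \<nu>) / 2) * R))"
    unfolding R_def N_def q'[symmetric] by simp
  have r: "?r = (D powr (1 / m)) powr (- (m * \<nu> / 2)) *
      ((N powr N * q) / ((2 * exp 1) powr N * (pi * \<nu>) powr \<nu>)) powr (m / 2) * R"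
    unfolding capacity_formula_def R_def N_def q_def by simp
  have "ln ?l = ln ?r"
    unfolding l r using R N q \<nu> D m
    by (simp add: ln_mult_pos ln_div ln_powr ln_realpow field_simps)
  moreover have "?l > 0" "?r > 0" unfolding l r using R N q \<nu> D by auto
  ultimately show ?thesis by simp
qed

lemma density_constant:
  fixes m n :: nat and \<nu> \<rho>2 D d :: real
  assumes m: "m > 0" and \<nu>: "\<nu> > 0" "\<nu> > real m - 1" and \<rho>2: "\<rho>2 > 0" and D: "D > 0" and d: "d > 0"
  shows "1 / ((2 * pi) powr (m * (n + \<nu>) / 2) * d powr ((n + \<nu>) / 2)) * exp (- (m * (n + \<nu>) / 2)) /
      capacity_formula m n \<nu> (D powr (1 / m)) \<rho>2
    = (\<nu> powr \<nu> / (pi powr n * (n + \<nu>) powr (n + \<nu>) * (1 + n / (\<rho>2 * \<nu>)))) powr (m / 2) *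
      (multi_Gamma m ((n + \<nu>) / 2) / multi_Gamma m (\<nu> / 2)) * (D powr (\<nu> / 2) / d powr ((n + \<nu>) / 2))"
    (is "?l = ?r")
proof -
  define R where "R = multi_Gamma m (\<nu> / 2)"
  define R' where "R' = multi_Gamma m ((n + \<nu>) / 2)"
  have R: "R > 0" "R' > 0" unfolding R_def R'_def using \<nu> by (intro multi_Gamma_pos; simp)+
  define N where "N = n + \<nu>"
  have N: "N > 0" using \<nu> by (simp add: N_def)
  define q where "q = 1 + n / (\<rho>2 * \<nu>)"
  have q: "q > 0" using \<nu> \<rho>2 by (simp add: q_def add_pos_nonneg)
  have n: "real n = N - \<nu>" by (simp add: N_def)
  have l: "?l = 1 / ((2 * pi) powr (m * N / 2) * d powr (N / 2)) * exp (- (m * N / 2)) /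
     ((D powr (1 / m)) powr (- (m * \<nu> / 2)) *
      ((N powr N * q) / ((2 * exp 1) powr N * (pi * \<nu>) powr \<nu>)) powr (m / 2) * (R / R'))"
    unfolding capacity_formula_def R_def R'_def N_def q_def by simp
  have r: "?r = (\<nu> powr \<nu> / (pi powr (N - \<nu>) * N powr N * q)) powr (m / 2) * (R' / R) * (D powr (\<nu> / 2) / d powr (N / 2))"
    unfolding R_def R'_def N_def q_def by simp
  have "ln ?l = ln ?r"
    unfolding l r using R N q \<nu> D d m
    by (simp add: ln_mult_pos ln_div ln_powr field_simps)
  moreover have "?l > 0" "?r > 0" unfolding l r using R N q \<nu> D d by auto
  ultimately show ?thesis by simp
qed

section \<open>Capacity and density\<close>

text \<open>
  The maximized likelihood is a constant times \<open>det W powr - (N / 2)\<close> for a scatter matrix \<open>W\<close> of the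
  centred sample, whose integral is known. The condition \<open>\<nu> > CARD('m) - 1\<close> is exactly the
  convergence condition for this exponent.
\<close>

lemma lnml_capacity_normal:
  fixes \<nu> \<rho>2 :: real and \<mu>0 :: "real^'m" and \<Sigma>0 :: "real^'m^'m"
  assumes \<nu>: "\<nu> > real CARD('m) - 1" and \<rho>2: "\<rho>2 > 0" and \<Sigma>0: "pos_def_matrix \<Sigma>0"
  shows "has_bochner_integral lborel
    (lnml_max (normal_lik :: real^'m^'n \<Rightarrow> _) (normal_luckiness \<nu> \<rho>2 \<mu>0 \<Sigma>0) normal_params)
    (capacity_formula CARD('m) CARD('n) \<nu> (det \<Sigma>0 powr (1 / CARD('m))) \<rho>2)"
proof -
  let ?m = "real CARD('m)" and ?n = "real CARD('n)"
  let ?M = "lnml_max (normal_lik :: real^'m^'n \<Rightarrow> _) (normal_luckiness \<nu> \<rho>2 \<mu>0 \<Sigma>0) normal_params"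
  let ?C = "capacity_formula CARD('m) CARD('n) \<nu> (det \<Sigma>0 powr (1 / ?m)) \<rho>2"
  define N where "N = ?n + \<nu>"
  define K where "K = ?n + \<rho>2 * \<nu>"
  have "?m \<ge> 1" by (simp add: Suc_leI)
  then have \<nu>0: "\<nu> > 0" using \<nu> by linarith
  then have N: "N > 0" by (simp add: N_def)
  have K: "K > ?n" using \<nu>0 \<rho>2 by (simp add: K_def)
  have a: "N / 2 > (?n - 1 + ?m) / 2" using \<nu> by (simp add: N_def)
  let ?W = "\<lambda>x :: real^'m^'n. det (scatter (\<nu> *\<^sub>R \<Sigma>0) UNIV K (\<lambda>i. x $ i - \<mu>0))"
  have B: "pos_def_matrix (\<nu> *\<^sub>R \<Sigma>0)" using \<nu>0 \<Sigma>0 by (rule pos_def_scaleR)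
  have dpos: "det \<Sigma>0 > 0" using \<Sigma>0 by (rule pos_def_det_pos)
  define c where "c = 1 / (2 * pi) powr (?m * N / 2) * exp (- (?m * N / 2)) * N powr (?m * N / 2)"
  have c: "c \<ge> 0" by (simp add: c_def)
  have M: "?M x = c * ?W x powr - (N / 2)" for x
  proof -
    have "pos_def_matrix (scatter (\<nu> *\<^sub>R \<Sigma>0) UNIV K (\<lambda>i. x $ i - \<mu>0))"
      using K by (intro pos_def_scatter B) auto
    then have W: "?W x > 0" by (rule pos_def_det_pos)
    have "det (map_cov \<nu> \<rho>2 \<mu>0 \<Sigma>0 x) = N powr - ?m * ?W x"
      using N by (simp add: map_cov_eq_scatter[OF \<nu>0 \<rho>2 \<Sigma>0] det_scaleR_matrix N_def[symmetric] K_def[symmetric]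
          power_one_over powr_minus powr_realpow inverse_eq_divide)
    then have dc: "det (map_cov \<nu> \<rho>2 \<mu>0 \<Sigma>0 x) powr (N / 2) = N powr - (?m * N / 2) * ?W x powr (N / 2)"
      using N W by (simp add: powr_mult powr_powr)
    show ?thesis
      unfolding lnml_max_eq_map[OF \<nu>0 \<rho>2 \<Sigma>0] penalised_likelihood_at_map[OF \<nu>0 \<rho>2 \<Sigma>0] N_def[symmetric] dc
      using N W by (simp add: c_def powr_minus field_simps)
  qed
  note int = nn_integral_det_scatter_vec[where 'n = 'n, OF B K a, of \<mu>0]
  have meas: "(\<lambda>x. ennreal (?W x powr - (N / 2))) \<in> borel_measurable borel"
    by (rule measurable_compose[OF int(1)]) measurable
  have measM: "?M \<in> borel_measurable lborel"
    unfolding M[abs_def] using int(1) by measurable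
  have "(\<integral>\<^sup>+x. ennreal (?M x) \<partial>lborel) = (\<integral>\<^sup>+x. ennreal c * ennreal (?W x powr - (N / 2)) \<partial>lborel)"
    unfolding M using c by (simp add: ennreal_mult')
  also have "\<dots> = ennreal c * (\<integral>\<^sup>+x. ennreal (?W x powr - (N / 2)) \<partial>lborel)"
    using meas by (intro nn_integral_cmult) simp
  also have "\<dots> = ennreal (c * (det (\<nu> *\<^sub>R \<Sigma>0) powr - (N / 2 - ?n / 2) * ((K - ?n) / K) powr - (?m / 2) *
      (\<Prod>k<CARD('n). pi powr (?m / 2) * Gamma (N / 2 - real k / 2 - ?m / 2) / Gamma (N / 2 - real k / 2))))"
    unfolding int(2) using c by (simp only: ennreal_mult')
  also have "c * (det (\<nu> *\<^sub>R \<Sigma>0) powr - (N / 2 - ?n / 2) * ((K - ?n) / K) powr - (?m / 2) *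
      (\<Prod>k<CARD('n). pi powr (?m / 2) * Gamma (N / 2 - real k / 2 - ?m / 2) / Gamma (N / 2 - real k / 2))) = ?C"
  proof -
    have e: "N / 2 - ?n / 2 = \<nu> / 2" "K - ?n = \<rho>2 * \<nu>" by (simp_all add: N_def K_def field_simps)
    show ?thesis
      using capacity_constant[OF _ \<nu>0 \<nu> \<rho>2 dpos, of "CARD('n)"]
      unfolding e unfolding N_def prod_Gamma_eq_multi_Gamma[OF \<nu>] det_scaleR_matrix c_def K_def by simp
  qed
  finally have *: "(\<integral>\<^sup>+x. ennreal (?M x) \<partial>lborel) = ennreal ?C" .
  have "?C \<ge> 0"
    unfolding capacity_formula_def using \<nu> \<nu>0
    by (intro mult_nonneg_nonneg divide_nonneg_nonneg less_imp_le[OF multi_Gamma_pos]) auto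
  then show ?thesis
    using measM * c by (intro has_bochner_integral_nn_integral) (auto simp: M)
qed

theorem theorem2:
  fixes \<nu> \<rho>2 :: real
    and \<mu>0 :: "real^'m"
    and \<Sigma>0 :: "real^'m^'m"
  assumes "\<nu> > real CARD('m) - 1"
    and "\<rho>2 > 0"
    and "pos_def_matrix \<Sigma>0"
  shows "let m = real CARD('m);
             n = real CARD('n);
             f = (normal_lik :: real^'m^'n \<Rightarrow> (real^'m) \<times> (real^'m^'m) \<Rightarrow> real);
             w = normal_luckiness \<nu> \<rho>2 \<mu>0 \<Sigma>0;
             C = capacity_formula CARD('m) CARD('n) \<nu> (det \<Sigma>0 powr (1 / m)) \<rho>2
         in
           integrable lborel (lnml_max f w normal_params) \<and>
           lnml_capacity f w normal_params = C \<and>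
           (\<forall>x. let \<mu>n = map_mean \<nu> \<rho>2 \<mu>0 x;
                    \<Sigma>n = map_cov \<nu> \<rho>2 \<mu>0 \<Sigma>0 x
                in
                  is_arg_max (\<lambda>\<theta>. f x \<theta> * w \<theta>) (\<lambda>\<theta>. \<theta> \<in> normal_params) (\<mu>n, \<Sigma>n) \<and>
                  lnml_density f w normal_params x = f x (\<mu>n, \<Sigma>n) * w (\<mu>n, \<Sigma>n) / C \<and>
                  f x (\<mu>n, \<Sigma>n) * w (\<mu>n, \<Sigma>n) / C =
                    (\<nu> powr \<nu> /
                      (pi powr n * (n + \<nu>) powr (n + \<nu>) * (1 + n / (\<rho>2 * \<nu>)))) powr (m / 2) *
                    (multi_Gamma CARD('m) ((n + \<nu>) / 2) / multi_Gamma CARD('m) (\<nu> / 2)) *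
                    (det \<Sigma>0 powr (\<nu> / 2) / det \<Sigma>n powr ((n + \<nu>) / 2)))"
proof -
  let ?f = "normal_lik :: real^'m^'n \<Rightarrow> (real^'m) \<times> (real^'m^'m) \<Rightarrow> real"
  let ?w = "normal_luckiness \<nu> \<rho>2 \<mu>0 \<Sigma>0"
  let ?C = "capacity_formula CARD('m) CARD('n) \<nu> (det \<Sigma>0 powr (1 / real CARD('m))) \<rho>2"
  have "real CARD('m) \<ge> 1" by (simp add: Suc_leI)
  then have \<nu>0: "\<nu> > 0" using assms(1) by linarith
  note int = lnml_capacity_normal[OF assms, of \<mu>0, where 'n = 'n]
  have cap: "lnml_capacity ?f ?w normal_params = ?C"
    unfolding lnml_capacity_def by (rule has_bochner_integral_integral_eq[OF int])
  have dens: "?f x (map_mean \<nu> \<rho>2 \<mu>0 x, map_cov \<nu> \<rho>2 \<mu>0 \<Sigma>0 x) * ?w (map_mean \<nu> \<rho>2 \<mu>0 x, map_cov \<nu> \<rho>2 \<mu>0 \<Sigma>0 x) / ?C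
    = (\<nu> powr \<nu> / (pi powr CARD('n) * (CARD('n) + \<nu>) powr (CARD('n) + \<nu>) * (1 + CARD('n) / (\<rho>2 * \<nu>)))) powr (CARD('m) / 2) *
      (multi_Gamma CARD('m) ((CARD('n) + \<nu>) / 2) / multi_Gamma CARD('m) (\<nu> / 2)) *
      (det \<Sigma>0 powr (\<nu> / 2) / det (map_cov \<nu> \<rho>2 \<mu>0 \<Sigma>0 x) powr ((CARD('n) + \<nu>) / 2))" for x
  proof -
    have "det \<Sigma>0 > 0" using assms(3) by (rule pos_def_det_pos)
    moreover have "det (map_cov \<nu> \<rho>2 \<mu>0 \<Sigma>0 x) > 0"
      by (rule pos_def_det_pos[OF pos_def_map_cov[OF \<nu>0 assms(2,3)]])
    ultimately show ?thesis
      unfolding penalised_likelihood_at_map[OF \<nu>0 assms(2,3)]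
      by (intro density_constant) (use \<nu>0 assms in auto)
  qed
  show ?thesis
    unfolding Let_def
    using integrable.intros[OF int] cap dens is_arg_max_map[OF \<nu>0 assms(2,3), where 'n = 'n]
    by (simp add: lnml_density_def lnml_max_eq_map[OF \<nu>0 assms(2,3)] cap)
qed

end
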